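(* For every $\gamma$ with $\frac1{12}\le\gamma\le\frac14$ there exists a threshold function $f:[0,1]\to[\frac12,1]$ such that the Framework algorithm run with the relaxation $LP_{EKS}$ and threshold function $f$ is a $\left(1.75+\gamma,\frac{1}{2\gamma+0.5}\right)$-approximation for Graph Balancing.
   Context: Graph Balancing: an undirected multigraph $G=(V,E)$ (self-loops allowed), weights $p_e>0$, nonnegative orientation costs $c_{e,u}$ ($e\in E,u\in e$). An orientation assigns each $e$ to $\eta(e)\in e$; load of $u$ is $\sum_{e:\eta(e)=u}p_e$; makespan is the maximum load; cost is $\sum_e c_{e,\eta(e)}$. $C(T)$ = minimum cost of an orientation of makespan $\le T$ ($\infty$ if none). An $(\alpha,\beta)$-approximation, given $T$, either correctly reports that no orientation of makespan $\le T$ exists or outputs one with makespan $\le\alpha T$ and cost $\le\beta C(T)$. Let $\delta(u)$ be the edges incident to $u$. After dividing all weights by $T$ (so the target is $1$), $LP_{EKS}$ has variables $x_{e,u}\ge0$: minimize $\sum_e\sum_{u\in e}c_{e,u}x_{e,u}$ subject to $\sum_{u\in e}x_{e,u}=1$ for all $e$ (Edge); $\sum_{e\in\delta(u)}x_{e,u}p_e\le1$ for all $u$ (Load); $\sum_{e\in\delta(u):p_e>1/2}x_{e,u}\le1$ for all $u$ (Star). Framework algorithm with relaxation $R$ and threshold $f:[0,1]\to[\frac12,1]$: if some $p_e>T$ or $R$ (after scaling) is infeasible, report that no orientation of makespan $\le T$ exists; otherwise compute an optimal solution $x$ of $R$. Local step: for each $e$ and $u\in e$, if $x_{e,u}>f(p_e)$,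 orient $e$ toward $u$ and remove $e$. Global step (Shmoys–Tardos rounding) on the set $E'$ of remaining edges: for each vertex $u$ create $\lceil\sum_{e\in E'\cap\delta(u)}x_{e,u}\rceil$ slots of capacity $1$; go through the edges $e\in E'\cap\delta(u)$ in non-increasing order of $p_e$ and pour $x_{e,u}$ units of $e$ into the current non-full slot of $u$, overflowing into the next slot; build a bipartite graph joining $e$ to each slot of $u$ that received a positive amount of $e$, with cost $c_{e,u}$; compute a minimum-cost matching that matches every edge of $E'$, and orient each $e\in E'$ toward the vertex owning its matched slot. *)

theory Defs
  imports Complex_Main "HOL-Library.FuncSet" "HOL-Library.Extended_Real"
begin

text \<open>
  A multigraph is given by a set of edge names and, for every edge, its set of endpoints; parallel
  edges are distinct names with equal endpoint sets, and a self-loop has a singleton endpoint set.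
\<close>

record ('v, 'e) gb_instance =
  verts :: "'v set"
  edges :: "'e set"
  ends :: "'e \<Rightarrow> 'v set"
  weight :: "'e \<Rightarrow> real"
  ocost :: "'e \<Rightarrow> 'v \<Rightarrow> real"

definition gb_valid :: "('v, 'e) gb_instance \<Rightarrow> bool" where
  "gb_valid I \<longleftrightarrow>
     finite (verts I) \<and> finite (edges I) \<and>
     (\<forall>e\<in>edges I. ends I e \<subseteq> verts I \<and> card (ends I e) \<in> {1, 2} \<and> weight I e > 0 \<and>
        (\<forall>u\<in>ends I e. ocost I e u \<ge> 0))"

definition incident :: "('v, 'e) gb_instance \<Rightarrow> 'v \<Rightarrow> 'e set" where
  "incident I u = {e \<in> edges I. u \<in> ends I e}"

definition orientations :: "('v, 'e) gb_instance \<Rightarrow> ('e \<Rightarrow> 'v) set" where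
  "orientations I = (\<Pi>\<^sub>E e\<in>edges I. ends I e)"

definition load :: "('v, 'e) gb_instance \<Rightarrow> ('e \<Rightarrow> 'v) \<Rightarrow> 'v \<Rightarrow> real" where
  "load I \<eta> u = (\<Sum>e\<in>{e \<in> edges I. \<eta> e = u}. weight I e)"

text \<open>Loads are nonnegative, so inserting \<open>0\<close> only matters for the graph without vertices.\<close>

definition makespan :: "('v, 'e) gb_instance \<Rightarrow> ('e \<Rightarrow> 'v) \<Rightarrow> real" where
  "makespan I \<eta> = Max (insert 0 (load I \<eta> ` verts I))"

definition orientation_cost :: "('v, 'e) gb_instance \<Rightarrow> ('e \<Rightarrow> 'v) \<Rightarrow> real" where
  "orientation_cost I \<eta> = (\<Sum>e\<in>edges I. ocost I e (\<eta> e))"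

text \<open>
  There are only finitely many orientations of a finite graph, so the infimum is a minimum, or
  \<open>\<infinity>\<close> if it ranges over the empty set.
\<close>

definition opt_cost :: "('v, 'e) gb_instance \<Rightarrow> real \<Rightarrow> ereal" where
  "opt_cost I T =
     (INF \<eta>\<in>{\<eta> \<in> orientations I. makespan I \<eta> \<le> T}. ereal (orientation_cost I \<eta>))"

datatype ('v, 'e) outcome = No_Orientation | Oriented "'e \<Rightarrow> 'v"

text \<open>
  An algorithm is a relation between inputs and outcomes, because it may leave choices open (ties,
  which optimal solution is used). The guarantee is required of every outcome that it can produce,
  and every input must admit at least one outcome.
\<close>

type_synonym ('v, 'e) gb_algorithm =
  "('v, 'e) gb_instance \<Rightarrow> real \<Rightarrow> ('v, 'e) outcome \<Rightarrow> bool"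

definition gb_approximation :: "real \<Rightarrow> real \<Rightarrow> ('v, 'e) gb_algorithm \<Rightarrow> bool" where
  "gb_approximation \<alpha> \<beta> alg \<longleftrightarrow>
     (\<forall>I T. gb_valid I \<and> T > 0 \<longrightarrow>
        (\<exists>r. alg I T r) \<and>
        (\<forall>r. alg I T r \<longrightarrow>
           (case r of
              No_Orientation \<Rightarrow> \<not> (\<exists>\<eta>\<in>orientations I. makespan I \<eta> \<le> T)
            | Oriented \<eta> \<Rightarrow>
                \<eta> \<in> orientations I \<and> makespan I \<eta> \<le> \<alpha> * T \<and>
                ereal (orientation_cost I \<eta>) \<le> ereal \<beta> * opt_cost I T)))"

definition scaled :: "('v, 'e) gb_instance \<Rightarrow> real \<Rightarrow> ('v, 'e) gb_instance" where
  "scaled I T = I\<lparr>weight := (\<lambda>e. weight I e / T)\<rparr>"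

text \<open>
  A relaxation assigns to an instance with target makespan \<open>1\<close> its set of feasible solutions
  \<open>x\<close>; only the entries \<open>x e u\<close> with \<open>u\<close> an endpoint of the edge \<open>e\<close> are meaningful.
\<close>

type_synonym ('v, 'e) relaxation = "('v, 'e) gb_instance \<Rightarrow> ('e \<Rightarrow> 'v \<Rightarrow> real) set"

definition LP_EKS :: "('v, 'e) relaxation" where
  "LP_EKS I =
     {x. (\<forall>e\<in>edges I. \<forall>u\<in>ends I e. x e u \<ge> 0) \<and>
         (\<forall>e\<in>edges I. (\<Sum>u\<in>ends I e. x e u) = 1) \<and>
         (\<forall>u\<in>verts I. (\<Sum>e\<in>incident I u. x e u * weight I e) \<le> 1) \<and>
         (\<forall>u\<in>verts I. (\<Sum>e\<in>{e \<in> incident I u. weight I e > 1/2}. x e u) \<le> 1)}"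

definition fractional_cost :: "('v, 'e) gb_instance \<Rightarrow> ('e \<Rightarrow> 'v \<Rightarrow> real) \<Rightarrow> real" where
  "fractional_cost I x = (\<Sum>e\<in>edges I. \<Sum>u\<in>ends I e. ocost I e u * x e u)"

definition optimal_solution ::
    "('v, 'e) relaxation \<Rightarrow> ('v, 'e) gb_instance \<Rightarrow> ('e \<Rightarrow> 'v \<Rightarrow> real) \<Rightarrow> bool" where
  "optimal_solution R I x \<longleftrightarrow>
     x \<in> R I \<and> (\<forall>y\<in>R I. fractional_cost I x \<le> fractional_cost I y)"

definition remaining ::
    "(real \<Rightarrow> real) \<Rightarrow> ('v, 'e) gb_instance \<Rightarrow> ('e \<Rightarrow> 'v \<Rightarrow> real) \<Rightarrow> 'e set" where
  "remaining f I x = {e \<in> edges I. \<not> (\<exists>u\<in>ends I e. x e u > f (weight I e))}"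

text \<open>
  \<open>pour a rs\<close> pours \<open>a\<close> units into slots with residual capacities \<open>rs\<close>, filling them from left to
  right, and returns the amount received by each slot; a full slot has residual capacity \<open>0\<close> and
  receives nothing. \<open>pour_all a rs es\<close> pours \<open>a e\<close> units of each \<open>e\<close> in the list \<open>es\<close> in turn; its
  value at \<open>e\<close> and \<open>j\<close> is the amount of \<open>e\<close> in slot \<open>j\<close>.
\<close>

fun pour :: "real \<Rightarrow> real list \<Rightarrow> real list" where
  "pour a [] = []"
| "pour a (r # rs) = min a r # pour (a - min a r) rs"

fun pour_all :: "('e \<Rightarrow> real) \<Rightarrow> real list \<Rightarrow> 'e list \<Rightarrow> 'e \<Rightarrow> nat \<Rightarrow> real" where
  "pour_all a rs [] = (\<lambda>e j. 0)"
| "pour_all a rs (e # es) =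
     (pour_all a (map2 (-) rs (pour (a e) rs)) es)
       (e := (\<lambda>j. if j < length rs then pour (a e) rs ! j else 0))"

definition num_slots ::
    "('v, 'e) gb_instance \<Rightarrow> ('e \<Rightarrow> 'v \<Rightarrow> real) \<Rightarrow> 'e set \<Rightarrow> 'v \<Rightarrow> nat" where
  "num_slots I x E' u = nat \<lceil>\<Sum>e\<in>E' \<inter> incident I u. x e u\<rceil>"

definition pouring_order :: "('v, 'e) gb_instance \<Rightarrow> 'e set \<Rightarrow> 'v \<Rightarrow> 'e list \<Rightarrow> bool" where
  "pouring_order I E' u es \<longleftrightarrow>
     distinct es \<and> set es = E' \<inter> incident I u \<and> sorted_wrt (\<lambda>e e'. weight I e \<ge> weight I e') es"

text \<open>
  The bipartite graph: \<open>(e, (u, j))\<close> joins the edge \<open>e\<close> to slot \<open>j\<close> of the vertex \<open>u\<close>, where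
  \<open>ord u\<close> is the order in which the edges at \<open>u\<close> are poured.
\<close>

definition slot_graph ::
    "('v, 'e) gb_instance \<Rightarrow> ('e \<Rightarrow> 'v \<Rightarrow> real) \<Rightarrow> 'e set \<Rightarrow> ('v \<Rightarrow> 'e list) \<Rightarrow> ('e \<times> 'v \<times> nat) set"
  where
  "slot_graph I x E' ord =
     {(e, u, j). e \<in> E' \<and> u \<in> ends I e \<and> j < num_slots I x E' u \<and>
        pour_all (\<lambda>e. x e u) (replicate (num_slots I x E' u) 1) (ord u) e j > 0}"

text \<open>Matchings that match all of \<open>E'\<close> are represented as injective functions on \<open>E'\<close>.\<close>

definition full_matching :: "('e \<times> 'v \<times> nat) set \<Rightarrow> 'e set \<Rightarrow> ('e \<Rightarrow> 'v \<times> nat) \<Rightarrow> bool" where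
  "full_matching B E' m \<longleftrightarrow> (\<forall>e\<in>E'. (e, m e) \<in> B) \<and> inj_on m E'"

definition matching_cost ::
    "('v, 'e) gb_instance \<Rightarrow> 'e set \<Rightarrow> ('e \<Rightarrow> 'v \<times> nat) \<Rightarrow> real" where
  "matching_cost I E' m = (\<Sum>e\<in>E'. ocost I e (fst (m e)))"

definition min_cost_full_matching ::
    "('v, 'e) gb_instance \<Rightarrow> ('e \<times> 'v \<times> nat) set \<Rightarrow> 'e set \<Rightarrow> ('e \<Rightarrow> 'v \<times> nat) \<Rightarrow> bool" where
  "min_cost_full_matching I B E' m \<longleftrightarrow>
     full_matching B E' m \<and>
     (\<forall>m'. full_matching B E' m' \<longrightarrow> matching_cost I E' m \<le> matching_cost I E' m')"

text \<open>Local and global step, for a solution \<open>x\<close> of the relaxation of the scaled instance \<open>I\<close>.\<close>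

definition rounding ::
    "(real \<Rightarrow> real) \<Rightarrow> ('v, 'e) gb_instance \<Rightarrow> ('e \<Rightarrow> 'v \<Rightarrow> real) \<Rightarrow> ('e \<Rightarrow> 'v) \<Rightarrow> bool" where
  "rounding f I x \<eta> \<longleftrightarrow>
     (let E' = remaining f I x in
        \<eta> \<in> extensional (edges I) \<and>
        (\<forall>e\<in>edges I - E'. \<eta> e \<in> ends I e \<and> x e (\<eta> e) > f (weight I e)) \<and>
        (\<exists>ord m.
           (\<forall>u\<in>verts I. pouring_order I E' u (ord u)) \<and>
           min_cost_full_matching I (slot_graph I x E' ord) E' m \<and>
           (\<forall>e\<in>E'. \<eta> e = fst (m e))))"

inductive framework :: "('v, 'e) relaxation \<Rightarrow> (real \<Rightarrow> real) \<Rightarrow> ('v, 'e) gb_algorithm"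
  for R :: "('v, 'e) relaxation" and f :: "real \<Rightarrow> real"
    and I :: "('v, 'e) gb_instance" and T :: real
where
  report:
    "(\<exists>e\<in>edges I. weight I e > T) \<or> R (scaled I T) = {} \<Longrightarrow> framework R f I T No_Orientation"
| orient:
    "\<not> ((\<exists>e\<in>edges I. weight I e > T) \<or> R (scaled I T) = {}) \<Longrightarrow>
     optimal_solution R (scaled I T) x \<Longrightarrow> rounding f (scaled I T) x \<eta> \<Longrightarrow>
     framework R f I T (Oriented \<eta>)"

end

theory Submission
  imports Defs "HOL-Analysis.Function_Topology"
begin

text \<open>
  Put \<open>g = 2 \<gamma> + 1/2\<close>; the threshold is \<open>1\<close> for edges of weight at most \<open>1/2\<close> and \<open>g\<close> for the big
  edges. The cost bound is immediate: an edge oriented locally pays at most \<open>1/g\<close> times its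
  fractional cost, and the minimum-cost matching is no more expensive than the fractional matching
  given by the pouring.

  For the load of a vertex \<open>u\<close>, note that the edge matched to a slot weighs at most the average of the
  preceding slot, so the matched edges weigh at most the heaviest of them plus the fractional load.
  If all remaining edges at \<open>u\<close> are small, then at most one edge \<open>e\<close> was oriented locally towards \<open>u\<close>
  and the load is at most \<open>1/2 + 1 + p\<^sub>e (1 - x\<^sub>e) \<le> 5/2 - g\<close>; this is where \<open>\<gamma> \<ge> 1/12\<close> enters. If
  there is a remaining big edge at \<open>u\<close>, then no edge was oriented locally towards \<open>u\<close>. Let \<open>h\<close> be the
  heaviest one. By the star constraint all big edges lie in the first slot, so the edge in the second
  slot weighs at most \<open>1/2\<close>, and since \<open>x\<^sub>h \<ge> 1 - g\<close> the load is at most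
  \<open>1 + p\<^sub>h (1 - x\<^sub>h) + x\<^sub>h / 2 \<le> 3/2 + g/2\<close>.
\<close>

section \<open>Rounding fractional matchings\<close>

text \<open>Gaussian elimination, by induction on the equations: a zero equation is dropped, any
  other one eliminates a pivot unknown, and either way there remain fewer equations than
  unknowns.\<close>

lemma homogeneous_system_nontrivial:
  fixes a :: "'k \<Rightarrow> 'i \<Rightarrow> real"
  assumes "finite K" "finite F" "card K < card F"
  shows "\<exists>d. (\<exists>i\<in>F. d i \<noteq> 0) \<and> (\<forall>k\<in>K. (\<Sum>i\<in>F. a k i * d i) = 0)"
  using assms
proof (induction K arbitrary: F a rule: finite_induct)
  case empty
  then have "F \<noteq> {}" by auto
  then show ?case by (intro exI[of _ "\<lambda>_. 1"]) auto
next
  case (insert k K)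
  show ?case
  proof (cases "\<forall>i\<in>F. a k i = 0")
    case True
    from insert.prems insert.hyps have "card K < card F" by simp
    from insert.IH[OF insert.prems(1) this, of a] obtain d
      where "\<exists>i\<in>F. d i \<noteq> 0" "\<forall>k\<in>K. (\<Sum>i\<in>F. a k i * d i) = 0" by blast
    with True show ?thesis by (intro exI[of _ d]) auto
  next
    case False
    then obtain j where j: "j \<in> F" "a k j \<noteq> 0" by blast
    \<comment> \<open>The coefficients left after unknown \<open>j\<close> has been eliminated with
      equation \<open>k\<close> as pivot. Back substitution in equation \<open>k\<close> later gives
      \<open>d' j\<close>.\<close>
    define a' where "a' = (\<lambda>k' i. a k' i - a k' j * a k i / a k j)"
    have "card K < card (F - {j})" using insert.prems insert.hyps j by simp
    from insert.IH[OF _ this, of a'] insert.prems obtain d where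
      d: "\<exists>i\<in>F-{j}. d i \<noteq> 0" "\<forall>k\<in>K. (\<Sum>i\<in>F-{j}. a' k i * d i) = 0" by auto
    define s where "s = (\<Sum>i\<in>F-{j}. a k i * d i)"
    define d' where "d' = d(j := - s / a k j)"
    have split: "(\<Sum>i\<in>F. a k' i * d' i) = (\<Sum>i\<in>F-{j}. a k' i * d i) - a k' j * s / a k j" for k'
    proof -
      have "(\<Sum>i\<in>F. a k' i * d' i) = a k' j * d' j + (\<Sum>i\<in>F-{j}. a k' i * d' i)"
        using insert.prems j by (simp add: sum.remove)
      also have "(\<Sum>i\<in>F-{j}. a k' i * d' i) = (\<Sum>i\<in>F-{j}. a k' i * d i)"
        by (intro sum.cong) (auto simp: d'_def)
      finally show ?thesis by (simp add: d'_def)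
    qed
    have "(\<Sum>i\<in>F. a k' i * d' i) = 0" if "k' \<in> K" for k'
    proof -
      have "0 = (\<Sum>i\<in>F-{j}. a k' i * d i - a k' j / a k j * (a k i * d i))"
        using d(2)[rule_format, OF that] by (simp add: a'_def algebra_simps)
      also have "\<dots> = (\<Sum>i\<in>F-{j}. a k' i * d i) - a k' j / a k j * s"
        by (simp add: sum_subtractf sum_distrib_left s_def)
      finally show ?thesis unfolding split by simp
    qed
    moreover have "(\<Sum>i\<in>F. a k i * d' i) = 0"
      unfolding split using j(2) by (simp add: s_def)
    moreover have "\<exists>i\<in>F. d' i \<noteq> 0" using d(1) by (auto simp: d'_def)
    ultimately show ?thesis by blast
  qed
qed

text \<open>If all other entries were 0 or 1, subtracting them from the integral total would make
  the entry \<open>v b\<close> an integer.\<close>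

lemma fractional_entry_not_alone:
  fixes v :: "'b \<Rightarrow> real"
  assumes "finite B" "\<And>b. b \<in> B \<Longrightarrow> 0 \<le> v b \<and> v b \<le> 1" "(\<Sum>b\<in>B. v b) \<in> \<int>"
    and "b \<in> B" "0 < v b" "v b < 1"
  shows "2 \<le> card {b \<in> B. 0 < v b \<and> v b < 1}"
proof -
  have "\<exists>b'\<in>B - {b}. 0 < v b' \<and> v b' < 1"
  proof (rule ccontr)
    assume "\<not> ?thesis"
    then have "v b' \<in> \<int>" if "b' \<in> B - {b}" for b'
      using assms(2)[of b'] that by (cases "v b' = 0"; cases "v b' = 1"; force)
    then have "(\<Sum>b'\<in>B - {b}. v b') \<in> \<int>" by (intro Ints_sum) auto
    with assms(3) have "(\<Sum>b\<in>B. v b) - (\<Sum>b'\<in>B - {b}. v b') \<in> \<int>" by (rule Ints_diff)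
    then have "v b \<in> \<int>" using assms(1,4) by (simp add: sum.remove)
    with assms(5,6) show False by (auto elim!: Ints_cases)
  qed
  then obtain b' where b': "b' \<in> B" "b' \<noteq> b" "0 < v b'" "v b' < 1" by blast
  have "card {b, b'} \<le> card {b \<in> B. 0 < v b \<and> v b < 1}"
    using assms b' by (intro card_mono) auto
  with b' show ?thesis by simp
qed

lemma two_card_fst_image_le:
  assumes "finite F" "\<And>a. a \<in> fst ` F \<Longrightarrow> 2 \<le> card {b. (a, b) \<in> F}"
  shows "2 * card (fst ` F) \<le> card F"
proof -
  have F: "F = Sigma (fst ` F) (\<lambda>a. {b. (a, b) \<in> F})" by force
  have fin: "finite {b. (a, b) \<in> F}" for a
    by (rule finite_subset[of _ "snd ` F"]) (use assms(1) in force)+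
  have "card F = (\<Sum>a\<in>fst ` F. card {b. (a, b) \<in> F})"
    by (subst F, subst card_SigmaI) (use assms(1) fin in auto)
  moreover have "(\<Sum>a\<in>fst ` F. 2) \<le> (\<Sum>a\<in>fst ` F. card {b. (a, b) \<in> F})"
    using assms(2) by (intro sum_mono) auto
  ultimately show ?thesis by simp
qed

lemma sum_of_bool_fst:
  fixes g :: "'a \<times> 'b \<Rightarrow> real"
  assumes "finite B" "F \<subseteq> A \<times> B" "finite F" "a \<in> A"
  shows "(\<Sum>i\<in>F. of_bool (fst i = a) * g i) = (\<Sum>b\<in>B. if (a, b) \<in> F then g (a, b) else 0)"
proof -
  have "(\<Sum>i\<in>F. of_bool (fst i = a) * g i) = (\<Sum>i\<in>{i\<in>F. fst i = a}. g i)"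
    unfolding sum.inter_filter[OF assms(3)] by (intro sum.cong) auto
  also have "\<dots> = (\<Sum>b\<in>{b\<in>B. (a, b) \<in> F}. g (a, b))"
    by (rule sum.reindex_bij_witness[of _ "\<lambda>b. (a, b)" snd]) (use assms in auto)
  also have "\<dots> = (\<Sum>b\<in>B. if (a, b) \<in> F then g (a, b) else 0)"
    using assms by (subst sum.inter_filter) auto
  finally show ?thesis .
qed

lemma sum_of_bool_snd:
  fixes g :: "'a \<times> 'b \<Rightarrow> real"
  assumes "finite A" "F \<subseteq> A \<times> B" "finite F" "b \<in> B"
  shows "(\<Sum>i\<in>F. of_bool (snd i = b) * g i) = (\<Sum>a\<in>A. if (a, b) \<in> F then g (a, b) else 0)"
proof -
  have "(\<Sum>i\<in>F. of_bool (snd i = b) * g i) = (\<Sum>i\<in>{i\<in>F. snd i = b}. g i)"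
    unfolding sum.inter_filter[OF assms(3)] by (intro sum.cong) auto
  also have "\<dots> = (\<Sum>a\<in>{a\<in>A. (a, b) \<in> F}. g (a, b))"
    by (rule sum.reindex_bij_witness[of _ "\<lambda>a. (a, b)" fst]) (use assms in auto)
  also have "\<dots> = (\<Sum>a\<in>A. if (a, b) \<in> F then g (a, b) else 0)"
    using assms by (subst sum.inter_filter) auto
  finally show ?thesis .
qed

text \<open>The unknowns are the cells of \<open>F\<close>, with one equation per row and per column
  that meets \<open>F\<close>. Two cells in each such row and column give at most
  \<open>card F\<close> equations; one of them is dependent, so a nonzero solution remains after
  dropping it.\<close>

lemma balanced_direction_exists:
  fixes F :: "('a \<times> 'b) set"
  assumes "finite A" "finite B" and F: "F \<subseteq> A \<times> B" "F \<noteq> {}"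
    and rows: "\<And>a. a \<in> fst ` F \<Longrightarrow> 2 \<le> card {b. (a, b) \<in> F}"
    and cols: "\<And>b. b \<in> snd ` F \<Longrightarrow> 2 \<le> card {a. (a, b) \<in> F}"
  shows "\<exists>d :: 'a \<Rightarrow> 'b \<Rightarrow> real. (\<exists>a b. d a b \<noteq> 0) \<and> (\<forall>a b. d a b \<noteq> 0 \<longrightarrow> (a, b) \<in> F) \<and>
    (\<forall>a\<in>A. (\<Sum>b\<in>B. d a b) = 0) \<and> (\<forall>b\<in>B. (\<Sum>a\<in>A. d a b) = 0)"
proof -
  have finF: "finite F" using assms finite_subset by blast
  let ?R = "fst ` F" and ?C = "snd ` F"
  from F obtain b0 where b0: "b0 \<in> ?C" by blast
  \<comment> \<open>The equations that are imposed: \<open>Inl\<close> marks rows and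
    \<open>Inr\<close> columns, with the column \<open>b0\<close> left out.\<close>
  define K where "K = Inl ` ?R \<union> Inr ` (?C - {b0})"
  have "2 * card ?R \<le> card F" using finF rows by (rule two_card_fst_image_le)
  moreover have "2 * card ?C \<le> card F"
  proof -
    let ?F' = "prod.swap ` F"
    have C: "fst ` ?F' = ?C" by (simp add: image_image)
    have "2 * card (fst ` ?F') \<le> card ?F'"
    proof (rule two_card_fst_image_le)
      fix b assume "b \<in> fst ` ?F'"
      moreover have "{a. (b, a) \<in> ?F'} = {a. (a, b) \<in> F}" by auto
      ultimately show "2 \<le> card {a. (b, a) \<in> ?F'}" using cols C by metis
    qed (use finF in simp)
    then show ?thesis unfolding C by (simp add: card_image)
  qed
  moreover have "card K = card ?R + (card ?C - 1)"
  proof -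
    have "card K = card (Inl ` ?R :: ('a + 'b) set) + card (Inr ` (?C - {b0}) :: ('a + 'b) set)"
      unfolding K_def using finF by (intro card_Un_disjoint) blast+
    then show ?thesis using b0 finF by (simp add: card_image)
  qed
  moreover have "card ?C > 0" using b0 finF card_gt_0_iff by blast
  ultimately have "card K < card F" by linarith
  have "finite K" unfolding K_def using finF by blast
  obtain d :: "'a \<times> 'b \<Rightarrow> real" where "(\<exists>i\<in>F. d i \<noteq> 0) \<and>
    (\<forall>k\<in>K. (\<Sum>i\<in>F. (case k of Inl a \<Rightarrow> of_bool (fst i = a) | Inr b \<Rightarrow> of_bool (snd i = b)) * d i) = 0)"
    using homogeneous_system_nontrivial[OF \<open>finite K\<close> finF \<open>card K < card F\<close>, where
        a = "\<lambda>k i. case k of Inl a \<Rightarrow> of_bool (fst i = a) | Inr b \<Rightarrow> of_bool (snd i = b)"] ..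
  note d = conjunct1[OF this] conjunct2[OF this]
  define D where "D = (\<lambda>a b. if (a, b) \<in> F then d (a, b) else 0)"
  have row: "(\<Sum>b\<in>B. D a b) = 0" if "a \<in> A" for a
  proof (cases "a \<in> ?R")
    case True
    then have "(\<Sum>i\<in>F. of_bool (fst i = a) * d i) = 0"
      using d(2)[rule_format, of "Inl a"] by (simp add: K_def)
    then show ?thesis
      using sum_of_bool_fst[OF assms(2) F(1) finF that, of d] by (simp add: D_def)
  next
    case False
    then have "(a, b) \<notin> F" for b by force
    then show ?thesis by (simp add: D_def)
  qed
  have col': "(\<Sum>a\<in>A. D a b) = 0" if "b \<in> B" "b \<noteq> b0" for b
  proof (cases "b \<in> ?C")
    case True
    with that have "Inr b \<in> K" by (auto simp: K_def)
    then have "(\<Sum>i\<in>F. of_bool (snd i = b) * d i) = 0"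
      using d(2)[rule_format, of "Inr b"] by simp
    then show ?thesis
      using sum_of_bool_snd[OF assms(1) F(1) finF that(1), of d] by (simp add: D_def)
  next
    case False
    then have "(a, b) \<notin> F" for a by force
    then show ?thesis by (simp add: D_def)
  qed
  have "b0 \<in> B" using b0 F by auto
  \<comment> \<open>One column equation is redundant: all rows and all columns have the same total.\<close>
  have "0 = (\<Sum>a\<in>A. \<Sum>b\<in>B. D a b)" using row by simp
  also have "\<dots> = (\<Sum>b\<in>B. \<Sum>a\<in>A. D a b)" by (rule sum.swap)
  also have "\<dots> = (\<Sum>a\<in>A. D a b0) + (\<Sum>b\<in>B-{b0}. \<Sum>a\<in>A. D a b)"
    using \<open>b0 \<in> B\<close> assms(2) by (rule sum.remove[rotated])
  also have "\<dots> = (\<Sum>a\<in>A. D a b0)" using col' by simp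
  finally have "(\<Sum>a\<in>A. D a b0) = 0" by simp
  with col' have "\<forall>b\<in>B. (\<Sum>a\<in>A. D a b) = 0" by blast
  moreover have "\<exists>a b. D a b \<noteq> 0" using d(1) by (auto simp: D_def)
  moreover have "\<forall>a b. D a b \<noteq> 0 \<longrightarrow> (a, b) \<in> F" by (simp add: D_def)
  ultimately show ?thesis using row by blast
qed

text \<open>As long as some entry is strictly between 0 and 1, move along a balanced direction
  supported on such entries, signed so that the cost does not grow, until an entry reaches 0 or 1.
  All row and column sums survive, and the number of fractional entries, the induction measure,
  drops.\<close>

lemma integral_sums_rounding:
  fixes y c :: "'a \<Rightarrow> 'b \<Rightarrow> real"
  assumes "finite A" "finite B"
    and "\<And>a b. a \<in> A \<Longrightarrow> b \<in> B \<Longrightarrow> 0 \<le> y a b \<and> y a b \<le> 1"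
    and "\<And>a. a \<in> A \<Longrightarrow> (\<Sum>b\<in>B. y a b) \<in> \<int>" and "\<And>b. b \<in> B \<Longrightarrow> (\<Sum>a\<in>A. y a b) \<in> \<int>"
  shows "\<exists>z. (\<forall>a\<in>A. \<forall>b\<in>B. z a b \<in> {0, 1} \<and> (y a b = 0 \<longrightarrow> z a b = 0)) \<and>
    (\<forall>a\<in>A. (\<Sum>b\<in>B. z a b) = (\<Sum>b\<in>B. y a b)) \<and> (\<forall>b\<in>B. (\<Sum>a\<in>A. z a b) = (\<Sum>a\<in>A. y a b)) \<and>
    (\<Sum>a\<in>A. \<Sum>b\<in>B. c a b * z a b) \<le> (\<Sum>a\<in>A. \<Sum>b\<in>B. c a b * y a b)"
  using assms(3-5)
proof (induction "card {(a, b) \<in> A \<times> B. 0 < y a b \<and> y a b < 1}" arbitrary: y rule: less_induct)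
  case less
  define F where "F = {(a, b) \<in> A \<times> B. 0 < y a b \<and> y a b < 1}"
  have F: "F \<subseteq> A \<times> B" by (auto simp: F_def)
  have finF: "finite F" using assms(1,2) F finite_subset by blast
  show ?case
  proof (cases "F = {}")
    case True
    have "y a b \<in> {0, 1}" if "a \<in> A" "b \<in> B" for a b
      using less.prems(1)[OF that] True that by (force simp: F_def)
    then show ?thesis by (intro exI[of _ y]) auto
  next
    case False
    have rows: "2 \<le> card {b. (a, b) \<in> F}" if "a \<in> fst ` F" for a
    proof -
      from that obtain b where b: "a \<in> A" "b \<in> B" "0 < y a b" "y a b < 1" by (auto simp: F_def)
      have "{b. (a, b) \<in> F} = {b \<in> B. 0 < y a b \<and> y a b < 1}" using b by (auto simp: F_def)
      then show ?thesis
        using fractional_entry_not_alone[of B "y a" b] assms(2) less.prems b by simp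
    qed
    have cols: "2 \<le> card {a. (a, b) \<in> F}" if "b \<in> snd ` F" for b
    proof -
      from that obtain a where a: "a \<in> A" "b \<in> B" "0 < y a b" "y a b < 1" by (auto simp: F_def)
      have "{a. (a, b) \<in> F} = {a \<in> A. 0 < y a b \<and> y a b < 1}" using a by (auto simp: F_def)
      then show ?thesis
        using fractional_entry_not_alone[of A "\<lambda>a. y a b" a] assms(1) less.prems a by simp
    qed
    obtain d0 :: "'a \<Rightarrow> 'b \<Rightarrow> real" where d0: "\<exists>a b. d0 a b \<noteq> 0"
      "\<forall>a b. d0 a b \<noteq> 0 \<longrightarrow> (a, b) \<in> F"
      "\<forall>a\<in>A. (\<Sum>b\<in>B. d0 a b) = 0" "\<forall>b\<in>B. (\<Sum>a\<in>A. d0 a b) = 0"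
      using balanced_direction_exists[OF assms(1,2) F False rows cols] by blast
    \<comment> \<open>A balanced direction may be negated, so one of the two signs does not raise
      the cost.\<close>
    define \<sigma> :: real where "\<sigma> = (if (\<Sum>a\<in>A. \<Sum>b\<in>B. c a b * d0 a b) \<le> 0 then 1 else -1)"
    define d where "d = (\<lambda>a b. \<sigma> * d0 a b)"
    have \<sigma>: "\<sigma> \<noteq> 0" by (simp add: \<sigma>_def)
    have d: "\<exists>a b. d a b \<noteq> 0" "\<And>a b. d a b \<noteq> 0 \<Longrightarrow> (a, b) \<in> F"
      "\<And>a. a \<in> A \<Longrightarrow> (\<Sum>b\<in>B. d a b) = 0" "\<And>b. b \<in> B \<Longrightarrow> (\<Sum>a\<in>A. d a b) = 0"
      using d0 \<sigma> by (auto simp: d_def sum_distrib_left[symmetric])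
    have "(\<Sum>a\<in>A. \<Sum>b\<in>B. c a b * d a b) = \<sigma> * (\<Sum>a\<in>A. \<Sum>b\<in>B. c a b * d0 a b)"
      by (simp add: d_def sum_distrib_left mult_ac)
    then have dcost: "(\<Sum>a\<in>A. \<Sum>b\<in>B. c a b * d a b) \<le> 0" by (simp add: \<sigma>_def)
    define D where "D = {(a, b). d a b \<noteq> 0}"
    have "D \<subseteq> F" using d(2) by (auto simp: D_def)
    then have finD: "finite D" using finF finite_subset by blast
    \<comment> \<open>How far one can move before this entry reaches 1 (if it grows) or 0 (if it
      shrinks). The minimum \<open>t\<close> is the first such event, attained at
      \<open>(a0, b0)\<close>.\<close>
    define step where
      "step = (\<lambda>(a, b). if d a b > 0 then (1 - y a b) / d a b else - y a b / d a b)"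
    define t where "t = Min (step ` D)"
    have "D \<noteq> {}" using d(1) by (auto simp: D_def)
    then have "t \<in> step ` D" using finD by (simp add: t_def)
    then obtain a0 b0 where ab0: "(a0, b0) \<in> D" "t = step (a0, b0)" by auto
    have t_le: "t \<le> step (a, b)" if "(a, b) \<in> D" for a b
      using finD that by (simp add: t_def)
    have "step (a, b) > 0" if "(a, b) \<in> D" for a b
    proof -
      from that \<open>D \<subseteq> F\<close> have "0 < y a b" "y a b < 1" "d a b \<noteq> 0" by (auto simp: F_def D_def)
      then show ?thesis by (auto simp: step_def field_simps)
    qed
    then have "t > 0" using ab0 by simp
    define y' where "y' = (\<lambda>a b. y a b + t * d a b)"
    have bnd: "0 \<le> y' a b \<and> y' a b \<le> 1" if "a \<in> A" "b \<in> B" for a b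
    proof (cases "d a b = 0")
      case True
      then show ?thesis using less.prems(1) that by (simp add: y'_def)
    next
      case False
      then have "(a, b) \<in> D" by (simp add: D_def)
      with \<open>D \<subseteq> F\<close> have y: "0 < y a b" "y a b < 1" by (auto simp: F_def)
      have le: "t \<le> step (a, b)" using t_le \<open>(a, b) \<in> D\<close> by blast
      show ?thesis
      proof (cases "d a b > 0")
        case True
        with le have "t * d a b \<le> 1 - y a b" by (simp add: step_def field_simps)
        moreover have "t * d a b > 0" using True \<open>t > 0\<close> by simp
        ultimately show ?thesis using y by (simp add: y'_def)
      next
        case neg: False
        with False have "d a b < 0" by simp
        with le have "t * d a b \<ge> - y a b" by (simp add: step_def field_simps)
        moreover have "t * d a b < 0" using \<open>d a b < 0\<close> \<open>t > 0\<close> by (simp add: mult_pos_neg)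
        ultimately show ?thesis using y by (simp add: y'_def)
      qed
    qed
    have row': "(\<Sum>b\<in>B. y' a b) = (\<Sum>b\<in>B. y a b)" if "a \<in> A" for a
      using d(3)[OF that] by (simp add: y'_def sum.distrib sum_distrib_left[symmetric])
    have col': "(\<Sum>a\<in>A. y' a b) = (\<Sum>a\<in>A. y a b)" if "b \<in> B" for b
      using d(4)[OF that] by (simp add: y'_def sum.distrib sum_distrib_left[symmetric])
    have "(\<Sum>a\<in>A. \<Sum>b\<in>B. c a b * y' a b)
      = (\<Sum>a\<in>A. \<Sum>b\<in>B. c a b * y a b) + t * (\<Sum>a\<in>A. \<Sum>b\<in>B. c a b * d a b)"
      by (simp add: y'_def sum.distrib sum_distrib_left algebra_simps)
    then have cost': "(\<Sum>a\<in>A. \<Sum>b\<in>B. c a b * y' a b) \<le> (\<Sum>a\<in>A. \<Sum>b\<in>B. c a b * y a b)"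
      using dcost \<open>t > 0\<close> by (simp add: mult_nonneg_nonpos)
    have "{(a, b) \<in> A \<times> B. 0 < y' a b \<and> y' a b < 1} \<subset> F"
    proof
      show "{(a, b) \<in> A \<times> B. 0 < y' a b \<and> y' a b < 1} \<subseteq> F"
      proof clarify
        fix a b assume "a \<in> A" "b \<in> B" "0 < y' a b" "y' a b < 1"
        then show "(a, b) \<in> F" using d(2)[of a b] by (cases "d a b = 0") (auto simp: y'_def F_def)
      qed
      \<comment> \<open>The entry that determined \<open>t\<close> has become integral, which makes
        the inclusion strict.\<close>
      have "d a0 b0 \<noteq> 0" using ab0 by (simp add: D_def)
      then have "y' a0 b0 = (if d a0 b0 > 0 then 1 else 0)"
        unfolding y'_def ab0(2) step_def by auto
      then have "(a0, b0) \<notin> {(a, b) \<in> A \<times> B. 0 < y' a b \<and> y' a b < 1}" by auto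
      moreover have "(a0, b0) \<in> F" using ab0 \<open>D \<subseteq> F\<close> by blast
      ultimately show "{(a, b) \<in> A \<times> B. 0 < y' a b \<and> y' a b < 1} \<noteq> F" by blast
    qed
    then have "card {(a, b) \<in> A \<times> B. 0 < y' a b \<and> y' a b < 1} < card F"
      using finF psubset_card_mono by blast
    then have "card {(a, b) \<in> A \<times> B. 0 < y' a b \<and> y' a b < 1}
        < card {(a, b) \<in> A \<times> B. 0 < y a b \<and> y a b < 1}"
      by (simp only: F_def)
    note IH = less.hyps[OF this]
    have rowint: "(\<Sum>b\<in>B. y' a b) \<in> \<int>" if "a \<in> A" for a
      using row'[OF that] less.prems(2)[OF that] by simp
    have colint: "(\<Sum>a\<in>A. y' a b) \<in> \<int>" if "b \<in> B" for b
      using col'[OF that] less.prems(3)[OF that] by simp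
    obtain z where z: "(\<forall>a\<in>A. \<forall>b\<in>B. z a b \<in> {0, 1} \<and> (y' a b = 0 \<longrightarrow> z a b = 0)) \<and>
      (\<forall>a\<in>A. (\<Sum>b\<in>B. z a b) = (\<Sum>b\<in>B. y' a b)) \<and> (\<forall>b\<in>B. (\<Sum>a\<in>A. z a b) = (\<Sum>a\<in>A. y' a b)) \<and>
      (\<Sum>a\<in>A. \<Sum>b\<in>B. c a b * z a b) \<le> (\<Sum>a\<in>A. \<Sum>b\<in>B. c a b * y' a b)"
      using IH[OF bnd rowint colint] ..
    \<comment> \<open>The direction vanishes off \<open>F\<close>, so zero entries stay zero and the
      support never grows.\<close>
    have "y' a b = 0" if "y a b = 0" for a b
      using that d(2)[of a b] by (cases "d a b = 0") (auto simp: y'_def F_def)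
    with z row' col' cost' show ?thesis by (intro exI[of _ z] conjI) (fastforce, simp, simp, linarith)
  qed
qed

text \<open>Absorbing the slack of the columns in an additional row makes all column sums 1, so
  \<open>integral_sums_rounding\<close> applies. Each original row of the 0/1 result has exactly one
  entry 1, whose position is \<open>m a\<close>.\<close>

lemma fractional_matching_rounding:
  fixes y c :: "'a \<Rightarrow> 'b \<Rightarrow> real"
  assumes "finite A" "finite B" and nonneg: "\<And>a b. a \<in> A \<Longrightarrow> b \<in> B \<Longrightarrow> 0 \<le> y a b"
    and rows: "\<And>a. a \<in> A \<Longrightarrow> (\<Sum>b\<in>B. y a b) = 1"
    and cols: "\<And>b. b \<in> B \<Longrightarrow> (\<Sum>a\<in>A. y a b) \<le> 1"
  shows "\<exists>m. inj_on m A \<and> (\<forall>a\<in>A. m a \<in> B \<and> y a (m a) > 0) \<and>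
    (\<Sum>a\<in>A. c a (m a)) \<le> (\<Sum>a\<in>A. \<Sum>b\<in>B. c a b * y a b)"
proof -
  \<comment> \<open>The extra row \<open>None\<close> holds the slack of the columns; its sum \<open>card B - card A\<close> is integral.\<close>
  define A' where "A' = insert None (Some ` A)"
  define y' where "y' = (\<lambda>a b. case a of None \<Rightarrow> 1 - (\<Sum>a\<in>A. y a b) | Some a \<Rightarrow> y a b)"
  define c' where "c' = (\<lambda>a b. case a of None \<Rightarrow> 0 | Some a \<Rightarrow> c a b)"
  have sumA': "(\<Sum>a\<in>A'. g a) = g None + (\<Sum>a\<in>A. g (Some a))" for g :: "'a option \<Rightarrow> real"
    using assms(1) by (simp add: A'_def sum.reindex)
  have le1: "y a b \<le> 1" if "a \<in> A" "b \<in> B" for a b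
    using member_le_sum[of b B "y a"] nonneg[OF that(1)] rows[OF that(1)] that assms(2) by auto
  have "(\<Sum>b\<in>B. y' None b) = real (card B) - real (card A)"
    using rows by (simp add: y'_def sum_subtractf sum.swap[of _ A B])
  then have rowint: "(\<Sum>b\<in>B. y' a b) \<in> \<int>" if "a \<in> A'" for a
    using rows that by (auto simp: A'_def y'_def)
  have colsum: "(\<Sum>a\<in>A'. y' a b) = 1" for b
    unfolding sumA' by (simp add: y'_def)
  then have colint: "(\<Sum>a\<in>A'. y' a b) \<in> \<int>" for b by simp
  have bnd: "0 \<le> y' a b \<and> y' a b \<le> 1" if "a \<in> A'" "b \<in> B" for a b
    using that nonneg le1 cols by (auto simp: A'_def y'_def sum_nonneg)
  have "finite A'" using assms(1) by (simp add: A'_def)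
  then obtain z where z: "\<forall>a\<in>A'. \<forall>b\<in>B. z a b \<in> {0, 1} \<and> (y' a b = 0 \<longrightarrow> z a b = 0)"
    "\<forall>a\<in>A'. (\<Sum>b\<in>B. z a b) = (\<Sum>b\<in>B. y' a b)" "\<forall>b\<in>B. (\<Sum>a\<in>A'. z a b) = (\<Sum>a\<in>A'. y' a b)"
    "(\<Sum>a\<in>A'. \<Sum>b\<in>B. c' a b * z a b) \<le> (\<Sum>a\<in>A'. \<Sum>b\<in>B. c' a b * y' a b)"
    using integral_sums_rounding[OF _ assms(2) bnd rowint colint] by blast
  define w where "w = (\<lambda>a b. z (Some a) b)"
  have w01: "w a b \<in> {0, 1}" "y a b = 0 \<Longrightarrow> w a b = 0" if "a \<in> A" "b \<in> B" for a b
    using z(1) that by (auto simp: w_def A'_def y'_def)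
  have wrow: "(\<Sum>b\<in>B. w a b) = 1" if "a \<in> A" for a
    using z(2) rows that by (auto simp: w_def A'_def y'_def)
  have wcol: "(\<Sum>a\<in>A. w a b) \<le> 1" if "b \<in> B" for b
  proof -
    have "z None b + (\<Sum>a\<in>A. w a b) = 1"
      using z(3) that colsum[of b] by (simp add: sumA' w_def)
    moreover have "z None b \<in> {0, 1}" using z(1) that by (simp add: A'_def)
    ultimately show ?thesis by auto
  qed
  have "\<exists>b\<in>B. w a b = 1" if "a \<in> A" for a
  proof (rule ccontr)
    assume "\<not> ?thesis"
    then have "(\<Sum>b\<in>B. w a b) = 0" using w01[OF that] by (intro sum.neutral) auto
    with wrow[OF that] show False by simp
  qed
  then obtain m where m: "\<And>a. a \<in> A \<Longrightarrow> m a \<in> B \<and> w a (m a) = 1" by metis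
  \<comment> \<open>Two rows choosing the same column would give that column a sum of at least
    2.\<close>
  have "inj_on m A"
  proof (rule inj_onI, rule ccontr)
    fix a1 a2 assume a: "a1 \<in> A" "a2 \<in> A" "m a1 = m a2" "a1 \<noteq> a2"
    have "(\<Sum>a\<in>{a1, a2}. w a (m a1)) \<le> (\<Sum>a\<in>A. w a (m a1))"
      using a assms(1) w01(1) m[OF a(1)] by (intro sum_mono2) force+
    moreover have "(\<Sum>a\<in>{a1, a2}. w a (m a1)) = 2"
      using a(3,4) m[OF a(1)] m[OF a(2)] by simp
    ultimately show False using wcol[of "m a1"] m[OF a(1)] by simp
  qed
  moreover have "y a (m a) > 0" if "a \<in> A" for a
    using nonneg[OF that, of "m a"] m[OF that] w01(2)[OF that, of "m a"] by force
  moreover have "(\<Sum>a\<in>A. c a (m a)) \<le> (\<Sum>a\<in>A. \<Sum>b\<in>B. c a b * y a b)"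
  proof -
    have "(\<Sum>b\<in>B. c a b * w a b) = c a (m a)" if "a \<in> A" for a
    proof -
      have "(\<Sum>b\<in>B. w a b) = w a (m a) + (\<Sum>b\<in>B - {m a}. w a b)"
        using assms(2) m[OF that] sum.remove by metis
      then have "(\<Sum>b\<in>B - {m a}. w a b) = 0" using wrow[OF that] m[OF that] by simp
      then have "\<forall>b\<in>B - {m a}. w a b = 0"
        using assms(2) w01(1)[OF that] by (subst (asm) sum_nonneg_eq_0_iff) force+
      then have "(\<Sum>b\<in>B - {m a}. c a b * w a b) = 0" by (intro sum.neutral) auto
      then show ?thesis
        using sum.remove[of B "m a" "\<lambda>b. c a b * w a b"] assms(2) m[OF that] by simp
    qed
    then have "(\<Sum>a\<in>A. c a (m a)) = (\<Sum>a\<in>A'. \<Sum>b\<in>B. c' a b * z a b)"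
      unfolding sumA' by (simp add: c'_def w_def)
    also have "\<dots> \<le> (\<Sum>a\<in>A'. \<Sum>b\<in>B. c' a b * y' a b)" by (rule z(4))
    also have "\<dots> = (\<Sum>a\<in>A. \<Sum>b\<in>B. c a b * y a b)"
      unfolding sumA' by (simp add: c'_def y'_def)
    finally show ?thesis .
  qed
  ultimately show ?thesis using m by blast
qed

section \<open>Pouring\<close>

text \<open>Place slot \<open>j\<close> on the real line as the interval from \<open>j\<close> to
  \<open>j + 1\<close>. Pouring a total of \<open>s\<close> from left to right covers the line from
  0 up to \<open>s\<close>, and this is the length of slot \<open>j\<close> left uncovered. What a
  later pouring adds to a slot is a difference of two residuals.\<close>

definition residual :: "real \<Rightarrow> nat \<Rightarrow> real" where
  "residual s j = max 0 (min 1 (real j + 1 - s))"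

lemma residual_antimono: "s \<le> s' \<Longrightarrow> residual s' j \<le> residual s j"
  by (auto simp: residual_def)

lemma residual_bounds: "0 \<le> residual s j" "residual s j \<le> 1"
  by (auto simp: residual_def)

lemma replicate_1_eq_residual: "replicate n 1 = map (residual 0) [0..<n]"
  by (rule nth_equalityI) (auto simp: residual_def)

lemma sum_residual: "0 \<le> s \<Longrightarrow> (\<Sum>j<n. residual s j) = max 0 (real n - s)"
  by (induction n) (auto simp: residual_def)

text \<open>The list starts at an arbitrary slot \<open>k\<close> for the sake of the induction.
  Then \<open>k <= s\<close> says that the slots before \<open>k\<close> are already full; the
  alternative \<open>a = 0\<close> is reached when the amount runs out before slot
  \<open>k - 1\<close> is full.\<close>

lemma pour_residual:
  assumes "0 \<le> a" "real k \<le> s \<or> a = 0"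
  shows "pour a (map (residual s) [k..<n]) = map (\<lambda>j. residual s j - residual (s + a) j) [k..<n]"
  using assms
proof (induction "n - k" arbitrary: k s a)
  case 0
  then show ?case by simp
next
  case (Suc d)
  then have "k < n" by simp
  then have upt: "[k..<n] = k # [Suc k..<n]" by (rule upt_conv_Cons)
  define q where "q = min a (residual s k)"
  have q: "0 \<le> q" "q \<le> a" using Suc.prems by (auto simp: q_def residual_def)
  have hd: "q = residual s k - residual (s + a) k"
    using Suc.prems by (auto simp: q_def residual_def min_def max_def)
  \<comment> \<open>After \<open>q\<close> units went into slot \<open>k\<close>, either that slot
    is full or nothing is left to pour: the invariant for \<open>Suc k\<close>.\<close>
  have next_slot: "real (Suc k) \<le> s + q \<or> a - q = 0"
    using Suc.prems by (auto simp: q_def residual_def min_def max_def)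
  \<comment> \<open>The \<open>q\<close> units fit into slot \<open>k\<close>, so counting them in
    the total does not touch any later slot.\<close>
  have later: "residual (s + q) j = residual s j" if "Suc k \<le> j" for j
  proof -
    have "real k + 1 \<le> real j" using that by linarith
    then show ?thesis using Suc.prems by (auto simp: q_def residual_def min_def max_def)
  qed
  have "pour (a - q) (map (residual s) [Suc k..<n]) = pour (a - q) (map (residual (s + q)) [Suc k..<n])"
    using later by (intro arg_cong[where f = "pour (a - q)"]) simp
  also have "\<dots> = map (\<lambda>j. residual (s + q) j - residual (s + q + (a - q)) j) [Suc k..<n]"
    using Suc.hyps(2) q next_slot by (intro Suc.hyps(1)) auto
  also have "\<dots> = map (\<lambda>j. residual s j - residual (s + a) j) [Suc k..<n]"
    using later by simp
  finally show ?case unfolding upt by (simp add: q_def[symmetric] hd[symmetric])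
qed

lemma residual_after_pour:
  assumes "0 \<le> a" "0 \<le> s"
  shows "map2 (-) (map (residual s) [0..<n]) (pour a (map (residual s) [0..<n]))
    = map (residual (s + a)) [0..<n]"
  using assms by (subst pour_residual) (auto intro!: nth_equalityI)

lemma pour_all_residual_Cons:
  assumes "0 \<le> a e" "0 \<le> s"
  shows "pour_all a (map (residual s) [0..<n]) (e # es) =
    (pour_all a (map (residual (s + a e)) [0..<n]) es)
      (e := (\<lambda>j. if j < n then residual s j - residual (s + a e) j else 0))"
proof -
  have "(\<lambda>j. if j < n then pour (a e) (map (residual s) [0..<n]) ! j else 0)
    = (\<lambda>j. if j < n then residual s j - residual (s + a e) j else 0)"
    using assms by (subst pour_residual) auto
  then show ?thesis using residual_after_pour[OF assms, of n] by simp
qed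

text \<open>On the line of slots, \<open>e\<close> covers the interval of length \<open>a e\<close>
  that begins at the total of the preceding amounts. The first occurrence in the list determines the
  value of \<open>pour_all\<close>, hence \<open>e\<close> must be absent from the prefix.\<close>

lemma pour_all_residual:
  assumes "e \<notin> set es" "\<forall>e'\<in>set (es @ [e]). 0 \<le> a e'" "0 \<le> s" "j < n"
  shows "pour_all a (map (residual s) [0..<n]) (es @ e # es') e j
    = residual (s + sum_list (map a es)) j - residual (s + sum_list (map a es) + a e) j"
  using assms
proof (induction es arbitrary: s)
  case Nil
  then show ?case
    unfolding append_Nil by (subst pour_all_residual_Cons) auto
next
  case (Cons e0 es)
  then have "pour_all a (map (residual (s + a e0)) [0..<n]) (es @ e # es') e j
    = residual (s + a e0 + sum_list (map a es)) j - residual (s + a e0 + sum_list (map a es) + a e) j"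
    by (intro Cons.IH) auto
  then show ?case
    using Cons.prems unfolding append_Cons by (subst pour_all_residual_Cons) (auto simp: add_ac)
qed

lemma sum_pour_all_residual:
  assumes "distinct es" "\<forall>e\<in>set es. 0 \<le> a e" "0 \<le> s" "j < n"
  shows "(\<Sum>e\<in>set es. pour_all a (map (residual s) [0..<n]) es e j)
    = residual s j - residual (s + sum_list (map a es)) j"
  using assms
proof (induction es arbitrary: s)
  case (Cons e es)
  have "(\<Sum>e'\<in>set es. pour_all a (map (residual s) [0..<n]) (e # es) e' j)
      = (\<Sum>e'\<in>set es. pour_all a (map (residual (s + a e)) [0..<n]) es e' j)"
    using Cons.prems by (intro sum.cong refl, subst pour_all_residual_Cons) auto
  also have "\<dots> = residual (s + a e) j - residual (s + a e + sum_list (map a es)) j"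
    using Cons.prems by (intro Cons.IH) auto
  moreover have "pour_all a (map (residual s) [0..<n]) (e # es) e j = residual s j - residual (s + a e) j"
    using Cons.prems by (subst pour_all_residual_Cons) auto
  ultimately show ?case using Cons.prems by (simp add: add_ac del: pour_all.simps)
qed simp

lemma pour_all_prefix:
  assumes "distinct es" "\<forall>e\<in>set es. 0 \<le> a e" "e \<in> set es"
  obtains es1 es2 P where "es = es1 @ e # es2" "P = sum_list (map a es1)" "0 \<le> P"
    "P + a e + sum_list (map a es2) = sum_list (map a es)" "0 \<le> sum_list (map a es2)"
    "\<And>j n. j < n \<Longrightarrow> pour_all a (replicate n 1) es e j = residual P j - residual (P + a e) j"
proof -
  from assms(3) obtain es1 es2 where es: "es = es1 @ e # es2" by (meson split_list)
  then have "pour_all a (replicate n 1) es e j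
    = residual (sum_list (map a es1)) j - residual (sum_list (map a es1) + a e) j" if "j < n" for n j
    using pour_all_residual[of e es1 a 0 j n es2] assms that by (simp add: replicate_1_eq_residual)
  moreover have "0 \<le> sum_list (map a es1)" "0 \<le> sum_list (map a es2)"
    using assms(2) es by (auto intro!: sum_list_nonneg)
  ultimately show ?thesis using es by (intro that[of es1 es2]) auto
qed

lemma pour_all_nonneg:
  assumes "distinct es" "\<forall>e\<in>set es. 0 \<le> a e" "e \<in> set es" "j < n"
  shows "0 \<le> pour_all a (replicate n 1) es e j"
proof -
  obtain P where "pour_all a (replicate n 1) es e j = residual P j - residual (P + a e) j"
    using pour_all_prefix[OF assms(1-3)] assms(4) by metis
  then show ?thesis using residual_antimono[of P "P + a e" j] assms(2,3) by simp
qed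

text \<open>The interval of \<open>e\<close> ends at or before the total amount, hence inside the
  first \<open>n\<close> slots, and nothing is spilled.\<close>

lemma sum_slots_pour_all:
  assumes "distinct es" "\<forall>e\<in>set es. 0 \<le> a e" "e \<in> set es" "sum_list (map a es) \<le> real n"
  shows "(\<Sum>j<n. pour_all a (replicate n 1) es e j) = a e"
proof -
  obtain es1 es2 P where "0 \<le> P" and le: "P + a e + sum_list (map a es2) = sum_list (map a es)"
    "0 \<le> sum_list (map a es2)" and
    eq: "\<And>j n. j < n \<Longrightarrow> pour_all a (replicate n 1) es e j = residual P j - residual (P + a e) j"
    using pour_all_prefix[OF assms(1-3)] by metis
  have "0 \<le> a e" using assms by blast
  have "(\<Sum>j<n. pour_all a (replicate n 1) es e j) = (\<Sum>j<n. residual P j) - (\<Sum>j<n. residual (P + a e) j)"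
    using eq by (simp add: sum_subtractf)
  also have "\<dots> = a e"
    using \<open>0 \<le> P\<close> \<open>0 \<le> a e\<close> le assms(4) by (simp add: sum_residual)
  finally show ?thesis .
qed

lemma sum_edges_pour_all:
  assumes "distinct es" "\<forall>e\<in>set es. 0 \<le> a e" "j < n"
  shows "(\<Sum>e\<in>set es. pour_all a (replicate n 1) es e j) = 1 - residual (sum_list (map a es)) j"
  using sum_pour_all_residual[OF assms(1,2), of 0 j n] assms(3)
  by (simp add: replicate_1_eq_residual) (simp add: residual_def)

text \<open>The interval of \<open>e\<close> ends beyond \<open>j\<close>, so at least
  \<open>j >= i + 1\<close> units are poured in all and slot \<open>i\<close> is covered.\<close>

lemma pour_all_earlier_slot_full:
  assumes "distinct es" "\<forall>e\<in>set es. 0 \<le> a e" "e \<in> set es" "j < n"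
    and "pour_all a (replicate n 1) es e j > 0" "i < j"
  shows "(\<Sum>e\<in>set es. pour_all a (replicate n 1) es e i) = 1"
proof -
  obtain es1 es2 P where le: "P + a e + sum_list (map a es2) = sum_list (map a es)"
    "0 \<le> sum_list (map a es2)" and
    eq: "pour_all a (replicate n 1) es e j = residual P j - residual (P + a e) j"
    using pour_all_prefix[OF assms(1-3)] assms(4) by metis
  then have "P + a e > real j"
    using assms(5) by (auto simp: residual_def min_def max_def split: if_splits)
  then have "sum_list (map a es) \<ge> real i + 1" using le assms(6) by linarith
  then have "residual (sum_list (map a es)) i = 0" by (simp add: residual_def)
  then show ?thesis using sum_edges_pour_all[OF assms(1,2), of i n] assms(4,6) by simp
qed

text \<open>The interval of \<open>e\<close> ends beyond \<open>j >= i + 1\<close>. An item poured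
  after \<open>e\<close> begins later still and misses slot \<open>i\<close>; hence
  \<open>e'\<close> is \<open>e\<close> itself or precedes it in the order.\<close>

lemma pour_all_earlier_slot_heavier:
  assumes "distinct es" "\<forall>e\<in>set es. 0 \<le> a e" "e \<in> set es" "e' \<in> set es" "j < n"
    and "pour_all a (replicate n 1) es e j > 0" "pour_all a (replicate n 1) es e' i > 0" "i < j"
    and sorted: "sorted_wrt (\<lambda>e e'. (w e' :: real) \<le> w e) es"
  shows "w e \<le> w e'"
proof -
  obtain es1 es2 P where es: "es = es1 @ e # es2" and P: "P = sum_list (map a es1)" and
    eq: "pour_all a (replicate n 1) es e j = residual P j - residual (P + a e) j"
    using pour_all_prefix[OF assms(1-3)] assms(5) by metis
  have j: "P + a e > real j"
    using assms(6) eq by (auto simp: residual_def min_def max_def split: if_splits)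
  consider "e' = e" | "e' \<in> set es1" | "e' \<in> set es2" using es assms(4) by auto
  then show ?thesis
  proof cases
    case 2
    then show ?thesis using sorted es by (auto simp: sorted_wrt_append)
  next
    case 3
    then obtain r1 r2 where r: "es2 = r1 @ e' # r2" by (meson split_list)
    define Q where "Q = sum_list (map a (es1 @ e # r1))"
    have "pour_all a (replicate n 1) es e' i = residual Q i - residual (Q + a e') i"
      using pour_all_residual[of e' "es1 @ e # r1" a 0 i n r2] assms(1,2,5,8) es r
      by (auto simp: replicate_1_eq_residual Q_def)
    then have "Q < real i + 1"
      using assms(7) by (auto simp: residual_def min_def max_def split: if_splits)
    moreover have "0 \<le> sum_list (map a r1)"
      using assms(2) es r by (auto intro!: sum_list_nonneg)
    then have "P + a e \<le> Q" by (simp add: Q_def P)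
    ultimately show ?thesis using j assms(8) by linarith
  qed simp
qed

section \<open>Sizes of matched items\<close>

text \<open>The interface between pouring and load analysis. Beyond the bookkeeping of amounts it
  retains two traces of the sorted greedy filling: slots before a used slot are full, and they hold
  items at least as large.\<close>

locale slot_filling =
  fixes A :: "'e set" and n :: nat and y :: "'e \<Rightarrow> nat \<Rightarrow> real" and x p :: "'e \<Rightarrow> real"
  assumes finite_items: "finite A"
    and size_nonneg: "e \<in> A \<Longrightarrow> 0 \<le> p e"
    and amount_nonneg: "e \<in> A \<Longrightarrow> j < n \<Longrightarrow> 0 \<le> y e j"
    and amount_total: "e \<in> A \<Longrightarrow> (\<Sum>j<n. y e j) = x e"
    and earlier_full: "e \<in> A \<Longrightarrow> j < n \<Longrightarrow> 0 < y e j \<Longrightarrow> i < j \<Longrightarrow> (\<Sum>e\<in>A. y e i) = 1"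
    and earlier_heavier:
      "e \<in> A \<Longrightarrow> e' \<in> A \<Longrightarrow> j < n \<Longrightarrow> 0 < y e j \<Longrightarrow> 0 < y e' i \<Longrightarrow> i < j \<Longrightarrow> p e \<le> p e'"
begin

definition slot_size :: "nat \<Rightarrow> real" where
  "slot_size j = (\<Sum>e\<in>A. y e j * p e)"

lemma slot_size_nonneg: "j < n \<Longrightarrow> 0 \<le> slot_size j"
  unfolding slot_size_def by (intro sum_nonneg mult_nonneg_nonneg amount_nonneg size_nonneg)

lemma amount_sum_nonneg: "e \<in> A \<Longrightarrow> 0 \<le> x e"
  using amount_total[of e] amount_nonneg[of e] sum_nonneg[of "{..<n}" "y e"] by simp

lemma sum_slot_size: "(\<Sum>j<n. slot_size j) = (\<Sum>e\<in>A. x e * p e)"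
proof -
  have "(\<Sum>j<n. slot_size j) = (\<Sum>e\<in>A. (\<Sum>j<n. y e j) * p e)"
    unfolding slot_size_def by (subst sum.swap) (simp add: sum_distrib_right)
  then show ?thesis using amount_total by simp
qed

text \<open>Slot \<open>i\<close> is full, so its size is a weighted average of item sizes, each of
  them at least \<open>p e\<close>.\<close>

lemma size_le_previous_slot:
  assumes "e \<in> A" "j < n" "0 < y e j" "i < j"
  shows "p e \<le> slot_size i"
proof -
  have "p e = (\<Sum>e'\<in>A. y e' i * p e)"
    using earlier_full[OF assms] by (simp add: sum_distrib_right[symmetric])
  also have "\<dots> \<le> slot_size i"
    unfolding slot_size_def
  proof (rule sum_mono)
    fix e' assume e': "e' \<in> A"
    have "0 \<le> y e' i" using amount_nonneg e' assms by auto
    then show "y e' i * p e \<le> y e' i * p e'"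
      using earlier_heavier[of e e' j i] assms e' by (cases "y e' i = 0") auto
  qed
  finally show ?thesis .
qed

text \<open>Each item is charged to the slot just before its own. Different items charge different
  slots, all with index at least \<open>i\<close>.\<close>

lemma matched_later_slots_le:
  assumes M: "M \<subseteq> A" "inj_on k M" "\<And>e. e \<in> M \<Longrightarrow> k e < n \<and> 0 < y e (k e)"
  shows "(\<Sum>e\<in>{e \<in> M. i < k e}. p e) \<le> (\<Sum>j\<in>{i..<n}. slot_size j)"
proof -
  let ?M = "{e \<in> M. i < k e}"
  \<comment> \<open>Subtraction truncates at 0, but \<open>i < k e\<close> keeps \<open>k e\<close>
    positive.\<close>
  have inj: "inj_on (\<lambda>e. k e - 1) ?M"
  proof (rule inj_onI)
    fix e e' assume "e \<in> ?M" "e' \<in> ?M" "k e - 1 = k e' - 1"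
    then have "k e = k e'" by auto
    then show "e = e'" using \<open>e \<in> ?M\<close> \<open>e' \<in> ?M\<close> M(2) by (auto dest: inj_onD)
  qed
  have "p e \<le> slot_size (k e - 1)" if "e \<in> ?M" for e
    using that M(1) M(3)[of e] by (intro size_le_previous_slot[of e "k e"]) auto
  then have "(\<Sum>e\<in>?M. p e) \<le> (\<Sum>e\<in>?M. slot_size (k e - 1))" by (rule sum_mono)
  also have "\<dots> = (\<Sum>j\<in>(\<lambda>e. k e - 1) ` ?M. slot_size j)"
    using sum.reindex[OF inj, of slot_size] by simp
  also have "\<dots> \<le> (\<Sum>j\<in>{i..<n}. slot_size j)"
    using M(3) slot_size_nonneg by (intro sum_mono2) force+
  finally show ?thesis .
qed

lemma sum_single_slot_le:
  assumes M: "M \<subseteq> A" "inj_on k M" and "\<And>e. e \<in> M \<Longrightarrow> k e = i \<Longrightarrow> p e \<le> P" "0 \<le> P"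
  shows "(\<Sum>e\<in>{e \<in> M. k e = i}. p e) \<le> P"
proof (cases "{e \<in> M. k e = i} = {}")
  case True
  then show ?thesis using assms(4) by (metis sum.empty)
next
  case False
  then obtain e where e: "e \<in> M" "k e = i" by blast
  then have "{e \<in> M. k e = i} = {e}" using M(2) by (auto dest: inj_onD)
  then show ?thesis using assms(3)[OF e] by simp
qed

text \<open>Only the item in slot 0 has no previous slot to charge, and it costs at most
  \<open>P\<close>. All others charge distinct slots, whose sizes add up to the fractional
  load.\<close>

lemma matched_size_le:
  assumes M: "M \<subseteq> A" "inj_on k M" "\<And>e. e \<in> M \<Longrightarrow> k e < n \<and> 0 < y e (k e)"
    and P: "\<And>e. e \<in> M \<Longrightarrow> p e \<le> P" "0 \<le> P"
  shows "(\<Sum>e\<in>M. p e) \<le> P + (\<Sum>e\<in>A. x e * p e)"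
proof -
  have "finite M" using M(1) finite_items finite_subset by blast
  have "M = {e \<in> M. k e = 0} \<union> {e \<in> M. 0 < k e}" by auto
  then have "(\<Sum>e\<in>M. p e) = (\<Sum>e\<in>{e \<in> M. k e = 0} \<union> {e \<in> M. 0 < k e}. p e)" by simp
  also have "\<dots> = (\<Sum>e\<in>{e \<in> M. k e = 0}. p e) + (\<Sum>e\<in>{e \<in> M. 0 < k e}. p e)"
    using \<open>finite M\<close> by (intro sum.union_disjoint) auto
  also have "\<dots> \<le> P + (\<Sum>j\<in>{0..<n}. slot_size j)"
    using sum_single_slot_le[OF M(1,2) P, of 0] matched_later_slots_le[OF M, of 0] by linarith
  finally show ?thesis using sum_slot_size by (simp add: atLeast0LessThan)
qed

text \<open>A sharper count for the first two slots: the item in slot 0 costs at most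
  \<open>p h\<close>, the one in slot 1 some \<open>q <= b\<close>, and the rest charge slots 1 and
  up. Slot 0 stays unspent; its size, at least \<open>x h * p h + (1 - x h) * q\<close>, is saved
  from the fractional load.\<close>

lemma matched_size_le_star:
  assumes M: "M \<subseteq> A" "inj_on k M" "\<And>e. e \<in> M \<Longrightarrow> k e < n \<and> 0 < y e (k e)"
    and star: "(\<Sum>e\<in>{e \<in> A. b < p e}. x e) \<le> 1" and "0 \<le> b"
    and h: "h \<in> A" "b < p h" "\<And>e. e \<in> A \<Longrightarrow> p e \<le> p h"
  shows "(\<Sum>e\<in>M. p e) \<le> (\<Sum>e\<in>A. x e * p e) + p h * (1 - x h) + x h * b"
proof -
  have "finite M" using M(1) finite_items finite_subset by blast
  \<comment> \<open>An item larger than \<open>b\<close> beyond slot 0 forces slot 0 to be filled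
    entirely with items larger than \<open>b\<close>. Together with its own share outside slot 0
    these exceed the star bound.\<close>
  have only_first: "p e \<le> b" if e: "e \<in> A" "j < n" "0 < y e j" "0 < j" for e j
  proof (rule ccontr)
    assume big: "\<not> p e \<le> b"
    let ?B = "{e \<in> A. b < p e}"
    have "y e' 0 = 0" if "e' \<in> A - ?B" for e'
      using earlier_heavier[of e e' j 0] amount_nonneg[of e' 0] that e big by force
    then have "(\<Sum>e\<in>A. y e 0) = (\<Sum>e\<in>?B. y e 0)"
      using finite_items by (intro sum.mono_neutral_right) auto
    then have "1 = (\<Sum>e\<in>?B. y e 0)" using earlier_full[OF e] by simp
    also have "\<dots> < (\<Sum>e\<in>?B. x e)"
    proof (rule sum_strict_mono_ex1)
      have le: "(\<Sum>i\<in>S. y e i) \<le> x e" if "e \<in> A" "S \<subseteq> {..<n}" for e S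
        unfolding amount_total[OF that(1), symmetric]
        using that amount_nonneg by (intro sum_mono2) auto
      show "\<forall>e\<in>?B. y e 0 \<le> x e" using le[of _ "{0}"] e(2) by auto
      have "(\<Sum>i\<in>{0, j}. y e i) \<le> x e" using le[of e "{0, j}"] e by auto
      then have "y e 0 < x e" using e by simp
      then show "\<exists>e\<in>?B. y e 0 < x e" using big e(1) by force
    qed (use finite_items in simp)
    finally show False using star by simp
  qed
  have xh: "0 \<le> x h" "x h \<le> 1"
  proof -
    show "0 \<le> x h" using amount_sum_nonneg h(1) .
    have "x h \<le> (\<Sum>e\<in>{e \<in> A. b < p e}. x e)"
      using h amount_sum_nonneg finite_items by (intro member_le_sum) auto
    with star show "x h \<le> 1" by simp
  qed
  have nn: "0 \<le> (\<Sum>e\<in>A. x e * p e) - x h * p h" "0 \<le> p h"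
  proof -
    have "x h * p h \<le> (\<Sum>e\<in>A. x e * p e)"
      using h amount_sum_nonneg size_nonneg finite_items
      by (intro member_le_sum[where f = "\<lambda>e. x e * p e"]) auto
    then show "0 \<le> (\<Sum>e\<in>A. x e * p e) - x h * p h" by simp
    show "0 \<le> p h" using size_nonneg h(1) .
  qed
  have first: "(\<Sum>e\<in>{e \<in> M. k e = 0}. p e) \<le> p h"
    using sum_single_slot_le[OF M(1,2), of 0 "p h"] h(3) M(1) nn(2) by blast
  show ?thesis
  \<comment> \<open>An item matched beyond slot 0 certifies that slot 0 is full. Without one,
    \<open>M\<close> has at most one item, and the \<open>x h * p h\<close> contained in the
    fractional load pays for the bound.\<close>
  proof (cases "\<exists>e\<in>M. 0 < k e")
    case False
    then have "{e \<in> M. k e = 0} = M" by auto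
    then have "(\<Sum>e\<in>M. p e) \<le> p h" using first by simp
    moreover have "0 \<le> x h * b" using xh(1) \<open>0 \<le> b\<close> by simp
    moreover have "p h * (1 - x h) = p h - x h * p h" by (simp add: algebra_simps)
    ultimately show ?thesis using nn(1) by linarith
  next
    case True
    then obtain e0 where e0: "e0 \<in> M" "0 < k e0" by blast
    then have e0': "e0 \<in> A" "k e0 < n" "0 < y e0 (k e0)" using M(1) M(3)[OF e0(1)] by auto
    have full: "(\<Sum>e\<in>A. y e 0) = 1" using earlier_full[OF e0' e0(2)] .
    have "0 < n" using e0' by simp
    have "y h 0 = x h"
    proof -
      have "y h j = 0" if "j < n" "0 < j" for j
        using only_first[OF h(1) that(1) _ that(2)] amount_nonneg[OF h(1) that(1)] h(2) by force
      then have "(\<Sum>j\<in>{..<n} - {0}. y h j) = 0" by (intro sum.neutral) auto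
      then show ?thesis
        using amount_total[OF h(1)] sum.remove[of "{..<n}" 0 "y h"] \<open>0 < n\<close> by simp
    qed
    \<comment> \<open>The size of the item matched to slot 1, or 0 if there is none.\<close>
    define q where "q = (\<Sum>e\<in>{e \<in> M. k e = 1}. p e)"
    have "q \<le> b"
      unfolding q_def
    proof (rule sum_single_slot_le[OF M(1,2) _ \<open>0 \<le> b\<close>])
      fix e assume "e \<in> M" "k e = 1"
      then show "p e \<le> b" using only_first[of e 1] M(1) M(3)[of e] by auto
    qed
    have q_le: "q \<le> p e" if "e \<in> A" "0 < y e 0" for e
      unfolding q_def
    proof (rule sum_single_slot_le[OF M(1,2)])
      fix e' assume "e' \<in> M" "k e' = 1"
      then show "p e' \<le> p e"
        using M(1) M(3)[of e'] earlier_heavier[of e' e 1 0] that by auto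
    qed (use size_nonneg that in simp)
    have "0 \<le> q" unfolding q_def using M(1) size_nonneg by (intro sum_nonneg) auto
    \<comment> \<open>The full slot 0 holds all \<open>x h\<close> units of \<open>h\<close> and
      \<open>1 - x h\<close> units of items at least as large as the one in slot 1.\<close>
    have slot0: "x h * p h + (1 - x h) * q \<le> slot_size 0"
    proof -
      have "(\<Sum>e\<in>A - {h}. y e 0) = 1 - x h"
        using full \<open>y h 0 = x h\<close> sum.remove[OF finite_items h(1), of "\<lambda>e. y e 0"] by simp
      then have "(1 - x h) * q = (\<Sum>e\<in>A - {h}. y e 0 * q)"
        by (simp add: sum_distrib_right[symmetric])
      also have "\<dots> \<le> (\<Sum>e\<in>A - {h}. y e 0 * p e)"
      proof (rule sum_mono)
        fix e assume "e \<in> A - {h}"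
        then show "y e 0 * q \<le> y e 0 * p e"
          using q_le[of e] amount_nonneg[of e 0] \<open>0 < n\<close> by (cases "y e 0 = 0") auto
      qed
      finally show ?thesis
        unfolding slot_size_def
        using \<open>y h 0 = x h\<close> sum.remove[OF finite_items h(1), of "\<lambda>e. y e 0 * p e"] by simp
    qed
    have "M = {e \<in> M. k e = 0} \<union> ({e \<in> M. k e = 1} \<union> {e \<in> M. 1 < k e})" by auto
    then have "(\<Sum>e\<in>M. p e) = (\<Sum>e\<in>{e \<in> M. k e = 0} \<union> ({e \<in> M. k e = 1} \<union> {e \<in> M. 1 < k e}). p e)"
      by simp
    also have "\<dots> = (\<Sum>e\<in>{e \<in> M. k e = 0}. p e) + (\<Sum>e\<in>{e \<in> M. k e = 1} \<union> {e \<in> M. 1 < k e}. p e)"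
      using \<open>finite M\<close> by (intro sum.union_disjoint) auto
    also have "(\<Sum>e\<in>{e \<in> M. k e = 1} \<union> {e \<in> M. 1 < k e}. p e) = q + (\<Sum>e\<in>{e \<in> M. 1 < k e}. p e)"
      unfolding q_def using \<open>finite M\<close> by (intro sum.union_disjoint) auto
    finally have "(\<Sum>e\<in>M. p e) \<le> p h + q + (\<Sum>j\<in>{1..<n}. slot_size j)"
      using first matched_later_slots_le[OF M, of 1] by linarith
    also have "(\<Sum>j\<in>{1..<n}. slot_size j) = (\<Sum>e\<in>A. x e * p e) - slot_size 0"
      using sum_slot_size sum.atLeast_Suc_lessThan[of 0 n slot_size] \<open>0 < n\<close>
      by (simp add: atLeast0LessThan)
    finally have "(\<Sum>e\<in>M. p e) \<le> (\<Sum>e\<in>A. x e * p e) + p h * (1 - x h) + x h * q"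
      using slot0 by (simp add: algebra_simps)
    moreover have "x h * q \<le> x h * b" using \<open>q \<le> b\<close> xh by (simp add: mult_left_mono)
    ultimately show ?thesis by linarith
  qed
qed

end

section \<open>Optimal solutions of the relaxation\<close>

lemma finite_ends: "gb_valid I \<Longrightarrow> e \<in> edges I \<Longrightarrow> finite (ends I e)"
  unfolding gb_valid_def using finite_subset by metis

lemma LP_EKS_le_1:
  assumes "gb_valid I" "x \<in> LP_EKS I" "e \<in> edges I" "u \<in> ends I e"
  shows "x e u \<le> 1"
proof -
  have "x e u \<le> (\<Sum>u\<in>ends I e. x e u)"
    using assms finite_ends by (intro member_le_sum) (auto simp: LP_EKS_def)
  then show ?thesis using assms(2,3) by (auto simp: LP_EKS_def)
qed

text \<open>A continuous cost attains its minimum on a compact set. The feasible set itself is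
  unbounded in the entries off the edge-endpoint pairs, so it is first cut down to solutions that
  vanish there.\<close>

lemma optimal_solution_LP_EKS_exists:
  fixes I :: "('v, 'e) gb_instance"
  assumes valid: "gb_valid I" and "LP_EKS I \<noteq> {}"
  shows "\<exists>x. optimal_solution LP_EKS I x"
proof -
  define D where "D = Sigma (edges I) (ends I)"
  \<comment> \<open>A box that pins the meaningless coordinates to 0. As a product of compact sets
    it is compact, even over infinite types.\<close>
  define C where "C = (\<Pi>\<^sub>E i\<in>UNIV. if i \<in> D then {0..1} else {0::real})"
  have "compactin (product_topology (\<lambda>_. euclidean) UNIV) C"
    unfolding C_def compactin_PiE by auto
  then have "compact C" by (simp add: euclidean_product_topology)
  have coord: "continuous_on UNIV (\<lambda>z. z i)" for i :: "'e \<times> 'v" and z :: "'e \<times> 'v \<Rightarrow> real"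
    by simp
  note cont = coord continuous_on_sum continuous_on_mult continuous_on_const
  define L where "L = {z. curry z \<in> LP_EKS I}"
  have "L = {z. \<forall>e\<in>edges I. \<forall>u\<in>ends I e. 0 \<le> z (e, u)} \<inter>
      {z. \<forall>e\<in>edges I. (\<Sum>u\<in>ends I e. z (e, u)) = 1} \<inter>
      {z. \<forall>u\<in>verts I. (\<Sum>e\<in>incident I u. z (e, u) * weight I e) \<le> 1} \<inter>
      {z. \<forall>u\<in>verts I. (\<Sum>e\<in>{e \<in> incident I u. weight I e > 1/2}. z (e, u)) \<le> 1}"
    by (auto simp: L_def LP_EKS_def)
  moreover have "closed {z :: 'e \<times> 'v \<Rightarrow> real. \<forall>e\<in>edges I. \<forall>u\<in>ends I e. 0 \<le> z (e, u)}"
    unfolding Ball_def by (intro closed_Collect_all closed_Collect_imp closed_Collect_le cont) auto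
  moreover have "closed {z :: 'e \<times> 'v \<Rightarrow> real. \<forall>e\<in>edges I. (\<Sum>u\<in>ends I e. z (e, u)) = 1}"
    unfolding Ball_def by (intro closed_Collect_all closed_Collect_imp closed_Collect_eq cont) auto
  moreover have "closed {z :: 'e \<times> 'v \<Rightarrow> real.
      \<forall>u\<in>verts I. (\<Sum>e\<in>incident I u. z (e, u) * weight I e) \<le> 1}"
    unfolding Ball_def by (intro closed_Collect_all closed_Collect_imp closed_Collect_le cont) auto
  moreover have "closed {z :: 'e \<times> 'v \<Rightarrow> real.
      \<forall>u\<in>verts I. (\<Sum>e\<in>{e \<in> incident I u. weight I e > 1/2}. z (e, u)) \<le> 1}"
    unfolding Ball_def by (intro closed_Collect_all closed_Collect_imp closed_Collect_le cont) auto
  ultimately have "closed L" by (simp only: closed_Int)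
  with \<open>compact C\<close> have "compact (C \<inter> L)" by (rule compact_Int_closed)
  \<comment> \<open>Zeroing the meaningless entries preserves feasibility and cost, so a minimum
    over the box is a minimum over all solutions.\<close>
  define pr where "pr = (\<lambda>x :: 'e \<Rightarrow> 'v \<Rightarrow> real. \<lambda>i. if i \<in> D then x (fst i) (snd i) else 0)"
  have pr_eq: "pr x (e, u) = x e u" if "e \<in> edges I" "u \<in> ends I e" for x e u
    using that by (simp add: pr_def D_def)
  have pr_in: "pr x \<in> C \<inter> L" if x: "x \<in> LP_EKS I" for x
  proof
    show "pr x \<in> C"
      using LP_EKS_le_1[OF valid x] x by (auto simp: C_def pr_def D_def LP_EKS_def)
    have "(\<Sum>e\<in>incident I u. curry (pr x) e u * weight I e) = (\<Sum>e\<in>incident I u. x e u * weight I e)" for u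
      by (intro sum.cong) (auto simp: incident_def pr_eq)
    moreover have "(\<Sum>e\<in>{e \<in> incident I u. weight I e > 1/2}. curry (pr x) e u)
        = (\<Sum>e\<in>{e \<in> incident I u. weight I e > 1/2}. x e u)" for u
      by (intro sum.cong) (auto simp: incident_def pr_eq)
    ultimately show "pr x \<in> L" using x pr_eq by (simp add: L_def LP_EKS_def)
  qed
  have cost_pr: "fractional_cost I (curry (pr x)) = fractional_cost I x" for x
    unfolding fractional_cost_def by (intro sum.cong refl) (simp add: pr_eq)
  have "continuous_on (C \<inter> L) (\<lambda>z. fractional_cost I (curry z))"
    unfolding fractional_cost_def curry_def
    by (rule continuous_on_subset[OF _ subset_UNIV]) (intro cont)
  moreover have "C \<inter> L \<noteq> {}" using assms(2) pr_in by blast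
  ultimately obtain z where z: "z \<in> C \<inter> L"
    "\<forall>z'\<in>C \<inter> L. fractional_cost I (curry z) \<le> fractional_cost I (curry z')"
    using continuous_attains_inf[OF \<open>compact (C \<inter> L)\<close>] by blast
  have "optimal_solution LP_EKS I (curry z)"
    unfolding optimal_solution_def
  proof
    show "curry z \<in> LP_EKS I" using z(1) by (simp add: L_def)
    show "\<forall>y\<in>LP_EKS I. fractional_cost I (curry z) \<le> fractional_cost I y"
      using z(2) pr_in cost_pr by metis
  qed
  then show ?thesis by blast
qed

section \<open>The rounding and its guarantees\<close>

lemma incident_subset: "incident I u \<subseteq> edges I"
  by (auto simp: incident_def)

lemma pouring_slot_filling:
  assumes valid: "gb_valid I" and x: "x \<in> LP_EKS I" and E': "E' \<subseteq> edges I"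
    and ord: "pouring_order I E' u es"
  shows "slot_filling (E' \<inter> incident I u) (num_slots I x E' u)
    (pour_all (\<lambda>e. x e u) (replicate (num_slots I x E' u) 1) es) (\<lambda>e. x e u) (weight I)"
    (is "slot_filling ?A ?n ?y ?x _")
proof -
  have es: "distinct es" "set es = ?A" "sorted_wrt (\<lambda>e e'. weight I e' \<le> weight I e) es"
    using ord by (auto simp: pouring_order_def)
  have nonneg: "\<forall>e\<in>set es. 0 \<le> ?x e" using x es(2) by (auto simp: incident_def LP_EKS_def)
  \<comment> \<open>The number of slots is the total rounded up, so everything poured at
    \<open>u\<close> fits.\<close>
  have "sum_list (map ?x es) = (\<Sum>e\<in>?A. x e u)"
    using es(1,2) by (metis sum_list_distinct_conv_sum_set)
  also have "\<dots> \<le> real ?n" unfolding num_slots_def by linarith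
  finally have total: "sum_list (map ?x es) \<le> real ?n" .
  show ?thesis
  proof
    show "finite ?A" using es(2) by (metis List.finite_set)
    show "0 \<le> weight I e" if "e \<in> ?A" for e
      using that E' valid by (auto simp: gb_valid_def intro: less_imp_le)
    show "0 \<le> ?y e j" if "e \<in> ?A" "j < ?n" for e j
      using pour_all_nonneg[OF es(1) nonneg] that es(2) by blast
    show "(\<Sum>j<?n. ?y e j) = ?x e" if "e \<in> ?A" for e
      using sum_slots_pour_all[OF es(1) nonneg _ total] that es(2) by blast
    show "(\<Sum>e\<in>?A. ?y e i) = 1" if "e \<in> ?A" "j < ?n" "0 < ?y e j" "i < j" for e i j
      using pour_all_earlier_slot_full[OF es(1) nonneg _ that(2-4)] that(1) unfolding es(2) by blast
    show "weight I e \<le> weight I e'"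
      if "e \<in> ?A" "e' \<in> ?A" "j < ?n" "0 < ?y e j" "0 < ?y e' i" "i < j" for e e' i j
      using pour_all_earlier_slot_heavier[OF es(1) nonneg _ _ that(3-6) es(3)] that(1,2)
      unfolding es(2) by blast
  qed
qed

text \<open>The poured amounts themselves are a fractional matching of \<open>E'\<close> into the
  slots, with exactly the fractional cost of \<open>E'\<close>. Rounding it stays within its
  support, that is, within the slot graph.\<close>

lemma full_slot_matching_exists:
  assumes valid: "gb_valid I" and x: "x \<in> LP_EKS I" and E': "E' \<subseteq> edges I"
    and ord: "\<And>u. u \<in> verts I \<Longrightarrow> pouring_order I E' u (ord u)"
  shows "\<exists>m. full_matching (slot_graph I x E' ord) E' m \<and>
    matching_cost I E' m \<le> (\<Sum>e\<in>E'. \<Sum>u\<in>ends I e. ocost I e u * x e u)"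
proof -
  define S where "S = Sigma (verts I) (\<lambda>u. {..<num_slots I x E' u})"
  define z where "z = (\<lambda>e u. pour_all (\<lambda>e. x e u) (replicate (num_slots I x E' u) 1) (ord u) e)"
  define y where "y = (\<lambda>e (u, j). if u \<in> ends I e then z e u j else 0)"
  define c where "c = (\<lambda>e (s :: 'a \<times> nat). ocost I e (fst s))"
  have fill: "slot_filling (E' \<inter> incident I u) (num_slots I x E' u) (\<lambda>e. z e u) (\<lambda>e. x e u) (weight I)"
    if "u \<in> verts I" for u
    using pouring_slot_filling[OF valid x E' ord[OF that]] by (simp add: z_def)
  have fin: "finite E'" "finite (verts I)"
    using valid E' finite_subset by (auto simp: gb_valid_def)
  then have "finite S" by (auto simp: S_def)
  have ends: "ends I e \<subseteq> verts I" if "e \<in> E'" for e using valid E' that by (auto simp: gb_valid_def)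
  have inc: "e \<in> E' \<inter> incident I u" if "e \<in> E'" "u \<in> ends I e" for e u
    using that E' by (auto simp: incident_def)
  \<comment> \<open>The weight \<open>g\<close> is left open to serve twice: the constant 1 yields
    the row sums, \<open>ocost I e\<close> the cost.\<close>
  have row: "(\<Sum>s\<in>S. g (fst s) * y e s) = (\<Sum>u\<in>ends I e. g u * x e u)"
    if e: "e \<in> E'" for e and g :: "'a \<Rightarrow> real"
  proof -
    have "(\<Sum>s\<in>S. g (fst s) * y e s) = (\<Sum>u\<in>verts I. \<Sum>j<num_slots I x E' u. g u * y e (u, j))"
      unfolding S_def using fin by (subst sum.Sigma) (auto intro!: sum.cong)
    also have "\<dots> = (\<Sum>u\<in>ends I e. \<Sum>j<num_slots I x E' u. g u * y e (u, j))"
      using fin ends[OF e] by (intro sum.mono_neutral_right) (auto simp: y_def)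
    also have "\<dots> = (\<Sum>u\<in>ends I e. g u * x e u)"
    proof (rule sum.cong[OF refl])
      fix u assume u: "u \<in> ends I e"
      then have "(\<Sum>j<num_slots I x E' u. z e u j) = x e u"
        using slot_filling.amount_total[OF fill inc[OF e u]] ends[OF e] by blast
      then show "(\<Sum>j<num_slots I x E' u. g u * y e (u, j)) = g u * x e u"
        using u by (simp add: y_def sum_distrib_left[symmetric])
    qed
    finally show ?thesis .
  qed
  have "(\<Sum>s\<in>S. y e s) = 1" if "e \<in> E'" for e
  proof -
    have "(\<Sum>u\<in>ends I e. x e u) = 1" using x E' that by (auto simp: LP_EKS_def)
    then show ?thesis using row[OF that, of "\<lambda>_. 1"] by simp
  qed
  moreover have "(\<Sum>e\<in>E'. y e s) \<le> 1" if "s \<in> S" for s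
  proof -
    from that obtain u j where s: "s = (u, j)" "u \<in> verts I" "j < num_slots I x E' u"
      by (auto simp: S_def)
    have "(\<Sum>e\<in>E'. y e s) = (\<Sum>e\<in>E' \<inter> incident I u. y e s)"
      using fin E' by (intro sum.mono_neutral_right) (auto simp: y_def s incident_def)
    also have "\<dots> = (\<Sum>e\<in>set (ord u). z e u j)"
      using ord[OF s(2)] by (intro sum.cong) (auto simp: y_def s incident_def pouring_order_def)
    also have "\<dots> \<le> 1"
    proof -
      have "\<forall>e\<in>set (ord u). 0 \<le> x e u" "distinct (ord u)"
        using x ord[OF s(2)] by (auto simp: pouring_order_def incident_def LP_EKS_def)
      then have "(\<Sum>e\<in>set (ord u). z e u j) = 1 - residual (\<Sum>e\<leftarrow>ord u. x e u) j"
        unfolding z_def by (intro sum_edges_pour_all s(3))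
      then show ?thesis using residual_bounds(1) by simp
    qed
    finally show ?thesis .
  qed
  moreover have "0 \<le> y e s" if "e \<in> E'" "s \<in> S" for e s
    using that slot_filling.amount_nonneg[OF fill inc] by (auto simp: y_def S_def)
  ultimately obtain m where m: "inj_on m E'" "\<forall>e\<in>E'. m e \<in> S \<and> y e (m e) > 0"
    "(\<Sum>e\<in>E'. c e (m e)) \<le> (\<Sum>e\<in>E'. \<Sum>s\<in>S. c e s * y e s)"
    using fractional_matching_rounding[OF fin(1) \<open>finite S\<close>, of y c] by blast
  have "(e, m e) \<in> slot_graph I x E' ord" if "e \<in> E'" for e
    using m(2)[rule_format, OF that] that
    by (cases "m e") (auto simp: slot_graph_def y_def z_def S_def split: if_splits)
  then have "full_matching (slot_graph I x E' ord) E' m"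
    using m(1) by (auto simp: full_matching_def)
  moreover have "matching_cost I E' m \<le> (\<Sum>e\<in>E'. \<Sum>u\<in>ends I e. ocost I e u * x e u)"
    using m(3) row by (simp add: matching_cost_def c_def)
  ultimately show ?thesis by blast
qed

text \<open>There may be infinitely many matching functions, as their values off \<open>E'\<close>
  are arbitrary, but the cost depends only on the restriction to \<open>E'\<close>, so only finitely
  many costs occur.\<close>

lemma min_cost_full_matching_exists:
  assumes "finite B" "full_matching B E' m0"
  shows "\<exists>m. min_cost_full_matching I B E' m"
proof -
  let ?C = "matching_cost I E' ` {m. full_matching B E' m}"
  have "(\<lambda>e. (e, m0 e)) ` E' \<subseteq> B" using assms(2) by (auto simp: full_matching_def)
  then have "finite (fst ` (\<lambda>e. (e, m0 e)) ` E')" using assms(1) finite_subset by blast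
  then have "finite E'" by (simp add: image_image)
  have "?C \<subseteq> matching_cost I E' ` (\<Pi>\<^sub>E e\<in>E'. snd ` B)"
  proof
    fix v assume "v \<in> ?C"
    then obtain m where m: "full_matching B E' m" "v = matching_cost I E' m" by blast
    then have "restrict m E' \<in> (\<Pi>\<^sub>E e\<in>E'. snd ` B)" by (force simp: full_matching_def)
    moreover have "v = matching_cost I E' (restrict m E')"
      unfolding m(2) matching_cost_def by (intro sum.cong) auto
    ultimately show "v \<in> matching_cost I E' ` (\<Pi>\<^sub>E e\<in>E'. snd ` B)" by blast
  qed
  moreover have "finite (\<Pi>\<^sub>E e\<in>E'. snd ` B)" using \<open>finite E'\<close> assms(1) by (intro finite_PiE) auto
  ultimately have fin: "finite ?C" using finite_subset by blast
  have "Min ?C \<in> ?C" using fin assms(2) by (intro Min_in) auto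
  then obtain m where m: "full_matching B E' m" "Min ?C = matching_cost I E' m" by auto
  have "matching_cost I E' m \<le> matching_cost I E' m'" if "full_matching B E' m'" for m'
    using Min_le[OF fin] m(2) that by (metis (mono_tags) imageI mem_Collect_eq)
  with m(1) show ?thesis by (auto simp: min_cost_full_matching_def)
qed

lemma finite_slot_graph:
  assumes "gb_valid I" "E' \<subseteq> edges I"
  shows "finite (slot_graph I x E' ord)"
proof (rule finite_subset)
  show "slot_graph I x E' ord \<subseteq> E' \<times> Sigma (verts I) (\<lambda>u. {..<num_slots I x E' u})"
    using assms by (auto simp: slot_graph_def gb_valid_def)
  show "finite (E' \<times> Sigma (verts I) (\<lambda>u. {..<num_slots I x E' u}))"
    using assms finite_subset[OF assms(2)] by (auto simp: gb_valid_def)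
qed

lemma pouring_order_exists:
  assumes "finite E'"
  shows "\<exists>es. pouring_order I E' u es"
proof -
  obtain xs where xs: "set xs = E' \<inter> incident I u" "distinct xs"
    using finite_distinct_list[of "E' \<inter> incident I u"] assms by blast
  have "sorted (map (\<lambda>e. - weight I e) (sort_key (\<lambda>e. - weight I e) xs))" by simp
  then have "pouring_order I E' u (sort_key (\<lambda>e. - weight I e) xs)"
    using xs by (simp add: pouring_order_def sorted_map)
  then show ?thesis by blast
qed

lemma remaining_subset: "remaining f I x \<subseteq> edges I"
  by (auto simp: remaining_def)

lemma rounding_exists:
  assumes valid: "gb_valid I" and x: "x \<in> LP_EKS I"
  shows "\<exists>\<eta>. rounding f I x \<eta>"
proof -
  let ?E = "remaining f I x"
  have "finite (edges I)" using valid by (simp add: gb_valid_def)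
  then have "finite ?E" by (rule finite_subset[OF remaining_subset])
  then have "\<exists>es. pouring_order I ?E u es" for u by (rule pouring_order_exists)
  then obtain ord where ord: "\<And>u. pouring_order I ?E u (ord u)" by metis
  obtain m0 where "full_matching (slot_graph I x ?E ord) ?E m0"
    using full_slot_matching_exists[OF valid x remaining_subset ord] by blast
  from min_cost_full_matching_exists[OF finite_slot_graph[OF valid remaining_subset] this]
  obtain m where m: "min_cost_full_matching I (slot_graph I x ?E ord) ?E m" ..
  have "\<forall>e\<in>edges I - ?E. \<exists>u. u \<in> ends I e \<and> x e u > f (weight I e)"
    by (auto simp: remaining_def)
  then obtain l where l: "\<And>e. e \<in> edges I - ?E \<Longrightarrow> l e \<in> ends I e \<and> x e (l e) > f (weight I e)"
    by metis
  define \<eta> where "\<eta> = restrict (\<lambda>e. if e \<in> ?E then fst (m e) else l e) (edges I)"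
  have "rounding f I x \<eta>"
    unfolding rounding_def Let_def
  proof (intro conjI exI[of _ ord] exI[of _ m])
    show "\<forall>e\<in>edges I - ?E. \<eta> e \<in> ends I e \<and> x e (\<eta> e) > f (weight I e)"
      using l by (simp add: \<eta>_def)
    show "\<forall>e\<in>?E. \<eta> e = fst (m e)"
      using remaining_subset[of f I x] by (auto simp: \<eta>_def)
  qed (use ord m in \<open>simp_all add: \<eta>_def\<close>)
  then show ?thesis by blast
qed

section \<open>Validity and cost of the rounded orientation\<close>

lemma rounding_orientation:
  assumes "rounding f I x \<eta>"
  shows "\<eta> \<in> orientations I"
proof -
  from assms obtain ord m where
    r: "\<eta> \<in> extensional (edges I)" "\<forall>e\<in>edges I - remaining f I x. \<eta> e \<in> ends I e"
    "full_matching (slot_graph I x (remaining f I x) ord) (remaining f I x) m"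
    "\<forall>e\<in>remaining f I x. \<eta> e = fst (m e)"
    by (auto simp: rounding_def Let_def min_cost_full_matching_def)
  have "\<eta> e \<in> ends I e" if "e \<in> remaining f I x" for e
    using r(3,4) that by (cases "m e") (force simp: full_matching_def slot_graph_def)
  with r(1,2) show ?thesis by (auto simp: orientations_def PiE_iff)
qed

text \<open>Local edges are compared one by one, since each has more than \<open>g\<close> at its
  chosen endpoint. The remaining edges are compared in total through the matching; there the factor
  is 1, which \<open>g <= 1\<close> weakens to \<open>1 / g\<close>.\<close>

lemma rounding_cost_le:
  assumes valid: "gb_valid I" and x: "x \<in> LP_EKS I" and round: "rounding f I x \<eta>"
    and g: "0 < g" "g \<le> 1" "\<And>e. e \<in> edges I \<Longrightarrow> g \<le> f (weight I e)"
  shows "orientation_cost I \<eta> \<le> 1 / g * fractional_cost I x"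
proof -
  let ?E = "remaining f I x"
  define C where "C = (\<lambda>e. \<Sum>u\<in>ends I e. ocost I e u * x e u)"
  have fin: "finite (edges I)" using valid by (simp add: gb_valid_def)
  have nn: "0 \<le> ocost I e u * x e u" if "e \<in> edges I" "u \<in> ends I e" for e u
    using that valid x by (auto simp: gb_valid_def LP_EKS_def)
  from round obtain ord m where
    loc: "\<forall>e\<in>edges I - ?E. \<eta> e \<in> ends I e \<and> x e (\<eta> e) > f (weight I e)"
    and ord: "\<forall>u\<in>verts I. pouring_order I ?E u (ord u)"
    and m: "min_cost_full_matching I (slot_graph I x ?E ord) ?E m"
    and \<eta>: "\<forall>e\<in>?E. \<eta> e = fst (m e)"
    by (auto simp: rounding_def Let_def)
  have "(\<Sum>e\<in>?E. ocost I e (\<eta> e)) = matching_cost I ?E m"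
    using \<eta> by (simp add: matching_cost_def)
  also have "\<dots> \<le> (\<Sum>e\<in>?E. C e)"
  proof -
    obtain m' where m': "full_matching (slot_graph I x ?E ord) ?E m'" "matching_cost I ?E m' \<le> (\<Sum>e\<in>?E. C e)"
      unfolding C_def using full_slot_matching_exists[OF valid x remaining_subset, of f x ord] ord by blast
    then show ?thesis using m by (force simp: min_cost_full_matching_def)
  qed
  also have "\<dots> \<le> (\<Sum>e\<in>?E. 1 / g * C e)"
  proof (rule sum_mono)
    fix e assume "e \<in> ?E"
    then have "0 \<le> C e" unfolding C_def by (intro sum_nonneg nn subsetD[OF remaining_subset])
    moreover have "1 \<le> 1 / g" using g by simp
    ultimately show "C e \<le> 1 / g * C e" using mult_right_mono[of 1 "1 / g" "C e"] by simp
  qed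
  finally have glob: "(\<Sum>e\<in>?E. ocost I e (\<eta> e)) \<le> (\<Sum>e\<in>?E. 1 / g * C e)" .
  have local: "ocost I e (\<eta> e) \<le> 1 / g * C e" if "e \<in> edges I - ?E" for e
  proof -
    have e: "\<eta> e \<in> ends I e" "g < x e (\<eta> e)" "e \<in> edges I" using loc g(3) that by force+
    have "0 \<le> ocost I e (\<eta> e)" using valid e by (auto simp: gb_valid_def)
    then have "g * ocost I e (\<eta> e) \<le> ocost I e (\<eta> e) * x e (\<eta> e)"
      using e(2) by (simp add: mult.commute mult_right_mono)
    also have "\<dots> \<le> C e"
      unfolding C_def using nn e finite_ends[OF valid]
      by (intro member_le_sum[where f = "\<lambda>u. ocost I e u * x e u"]) auto
    finally show ?thesis using g(1) by (simp add: field_simps)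
  qed
  have "orientation_cost I \<eta> = (\<Sum>e\<in>edges I - ?E. ocost I e (\<eta> e)) + (\<Sum>e\<in>?E. ocost I e (\<eta> e))"
    unfolding orientation_cost_def using fin remaining_subset by (rule sum.subset_diff[rotated])
  also have "\<dots> \<le> (\<Sum>e\<in>edges I - ?E. 1 / g * C e) + (\<Sum>e\<in>?E. 1 / g * C e)"
    by (intro add_mono[OF sum_mono glob] local)
  also have "\<dots> = (\<Sum>e\<in>edges I. 1 / g * C e)"
    using fin remaining_subset by (rule sum.subset_diff[rotated, symmetric])
  finally show ?thesis by (simp add: fractional_cost_def C_def sum_distrib_left)
qed

section \<open>Load of the rounded orientation\<close>

lemma remaining_lower_bound:
  assumes valid: "gb_valid I" and x: "x \<in> LP_EKS I"
    and e: "e \<in> remaining f I x" "u \<in> ends I e" and "0 \<le> f (weight I e)"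
  shows "1 - f (weight I e) \<le> x e u"
proof -
  have e': "e \<in> edges I" "\<And>v. v \<in> ends I e \<Longrightarrow> x e v \<le> f (weight I e)"
    using e by (auto simp: remaining_def not_less)
  have fin: "finite (ends I e)" using finite_ends[OF valid e'(1)] .
  have "card (ends I e) \<le> 2" using valid e'(1) by (auto simp: gb_valid_def)
  then have "card (ends I e - {u}) \<le> 1" using fin e(2) by simp
  then have single: "v = v'" if "v \<in> ends I e - {u}" "v' \<in> ends I e - {u}" for v v'
    using fin that card_le_Suc0_iff_eq[of "ends I e - {u}"] by simp
  \<comment> \<open>At most one other endpoint exists, and it holds at most the threshold because
    the edge was not removed. For a self-loop the sum is empty.\<close>
  have "(\<Sum>v\<in>ends I e - {u}. x e v) \<le> f (weight I e)"
  proof (cases "ends I e - {u} = {}")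
    case True
    show ?thesis unfolding True using assms(5) by simp
  next
    case False
    then obtain v where v: "v \<in> ends I e - {u}" by blast
    then have eq: "ends I e - {u} = {v}" using single by blast
    have "x e v \<le> f (weight I e)" using e'(2) v by blast
    then show ?thesis unfolding eq by simp
  qed
  moreover have "x e u + (\<Sum>v\<in>ends I e - {u}. x e v) = 1"
    using x e'(1) sum.remove[OF fin e(2), of "x e"] by (auto simp: LP_EKS_def)
  ultimately show ?thesis by linarith
qed

text \<open>
  An edge that the local step orients towards \<open>u\<close> has more than \<open>g\<close> of the unit that the star
  constraint grants to the big edges at \<open>u\<close>, while a remaining big edge has at least \<open>1 - g\<close>. So the
  two kinds never meet at \<open>u\<close>.
\<close>

lemma rounding_load_le:
  assumes valid: "gb_valid I" and x: "x \<in> LP_EKS I" and round: "rounding f I x \<eta>"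
    and g: "2/3 \<le> g" "g \<le> 1" and f: "f = (\<lambda>p. if p \<le> 1/2 then 1 else g)"
    and w1: "\<And>e. e \<in> edges I \<Longrightarrow> weight I e \<le> 1" and u: "u \<in> verts I"
  shows "load I \<eta> u \<le> 3/2 + g / 2"
proof -
  let ?E = "remaining f I x"
  let ?w = "weight I"
  from round obtain ord m where
    loc: "\<forall>e\<in>edges I - ?E. \<eta> e \<in> ends I e \<and> x e (\<eta> e) > f (?w e)"
    and ord: "\<forall>u\<in>verts I. pouring_order I ?E u (ord u)"
    and m: "full_matching (slot_graph I x ?E ord) ?E m"
    and \<eta>: "\<forall>e\<in>?E. \<eta> e = fst (m e)"
    by (auto simp: rounding_def Let_def min_cost_full_matching_def)
  define A where "A = ?E \<inter> incident I u"
  define M where "M = {e \<in> ?E. \<eta> e = u}"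
  define L where "L = {e \<in> edges I - ?E. \<eta> e = u}"
  define z where "z = pour_all (\<lambda>e. x e u) (replicate (num_slots I x ?E u) 1) (ord u)"
  have fin: "finite (edges I)" using valid by (simp add: gb_valid_def)
  have finI: "finite (incident I u)" using finite_subset[OF incident_subset fin] .
  interpret slot_filling A "num_slots I x ?E u" z "\<lambda>e. x e u" ?w
    unfolding A_def z_def
    by (rule pouring_slot_filling[OF valid x remaining_subset ord[rule_format, OF u]])
  have matched: "u \<in> ends I e \<and> snd (m e) < num_slots I x ?E u \<and> 0 < z e (snd (m e))"
    if "e \<in> M" for e
  proof -
    have "(e, m e) \<in> slot_graph I x ?E ord" using m that by (simp add: M_def full_matching_def)
    moreover have "fst (m e) = u" using \<eta> that by (auto simp: M_def)
    ultimately show ?thesis by (cases "m e") (simp add: slot_graph_def z_def)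
  qed
  have M1: "M \<subseteq> A"
    using matched remaining_subset[of f I x] by (auto simp: A_def M_def incident_def)
  \<comment> \<open>All these slots belong to \<open>u\<close>, so the slot index alone
    distinguishes them.\<close>
  have M2: "inj_on (\<lambda>e. snd (m e)) M"
  proof (rule inj_onI)
    fix e e' assume e: "e \<in> M" "e' \<in> M" "snd (m e) = snd (m e')"
    then have "m e = m e'" using \<eta> by (auto simp: M_def prod_eq_iff)
    moreover have "inj_on m ?E" "e \<in> ?E" "e' \<in> ?E"
      using m e by (simp_all add: M_def full_matching_def)
    ultimately show "e = e'" by (metis inj_onD)
  qed
  note M = M1 M2 conjunct2[OF matched]
  have load: "load I \<eta> u = (\<Sum>e\<in>L. ?w e) + (\<Sum>e\<in>M. ?w e)"
  proof -
    have "{e \<in> edges I. \<eta> e = u} = L \<union> M"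
      using remaining_subset[of f I x] by (auto simp: L_def M_def)
    moreover have "finite L" "L \<inter> M = {}" using fin by (auto simp: L_def M_def)
    moreover have "finite M" using M(1) finite_items finite_subset by blast
    ultimately show ?thesis by (simp add: load_def sum.union_disjoint)
  qed
  have x_nonneg: "0 \<le> x e u" if "e \<in> incident I u" for e
    using that x by (auto simp: incident_def LP_EKS_def)
  have w_nonneg: "0 \<le> ?w e" if "e \<in> incident I u" for e
    using that valid by (auto simp: incident_def gb_valid_def less_imp_le)
  have loadc: "(\<Sum>e\<in>incident I u. x e u * ?w e) \<le> 1" using x u by (simp add: LP_EKS_def)
  have starc: "(\<Sum>e\<in>S. x e u) \<le> 1" if "S \<subseteq> {e \<in> incident I u. 1/2 < ?w e}" for S
  proof -
    have "(\<Sum>e\<in>S. x e u) \<le> (\<Sum>e\<in>{e \<in> incident I u. 1/2 < ?w e}. x e u)"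
      using that finI x_nonneg by (intro sum_mono2) auto
    then show ?thesis using x u by (auto simp: LP_EKS_def)
  qed
  \<comment> \<open>Edges of weight at most \<open>1/2\<close> have threshold 1, which no entry of a
    solution exceeds; so local edges are big.\<close>
  have L: "e \<in> incident I u" "1/2 < ?w e" "g < x e u" "e \<notin> A" if "e \<in> L" for e
  proof -
    have e: "e \<in> edges I" "u \<in> ends I e" "f (?w e) < x e u" "e \<notin> ?E"
      using that loc by (auto simp: L_def)
    then show "e \<in> incident I u" "e \<notin> A" by (auto simp: incident_def A_def)
    have "x e u \<le> 1" using LP_EKS_le_1[OF valid x e(1,2)] .
    with e(3) show "1/2 < ?w e" "g < x e u" by (auto simp: f split: if_splits)
  qed
  \<comment> \<open>Local edges use up part of the load constraint at \<open>u\<close>; only the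
    rest is available to the poured edges.\<close>
  have rem: "(\<Sum>e\<in>A. x e u * ?w e) + (\<Sum>e\<in>L. x e u * ?w e) \<le> 1"
  proof -
    have "finite L" using fin by (simp add: L_def)
    then have "(\<Sum>e\<in>A. x e u * ?w e) + (\<Sum>e\<in>L. x e u * ?w e) = (\<Sum>e\<in>A \<union> L. x e u * ?w e)"
      using finite_items L(4) by (intro sum.union_disjoint[symmetric]) auto
    also have "\<dots> \<le> (\<Sum>e\<in>incident I u. x e u * ?w e)"
      using finI L(1) x_nonneg w_nonneg by (intro sum_mono2) (auto simp: A_def)
    finally show ?thesis using loadc by simp
  qed
  show ?thesis
  proof (cases "\<exists>e\<in>A. 1/2 < ?w e")
    case True
    have "A \<noteq> {}" using True by blast
    then have "Max (?w ` A) \<in> ?w ` A" using finite_items by (intro Max_in) auto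
    then obtain h where h: "h \<in> A" "Max (?w ` A) = ?w h" by blast
    have max: "?w e \<le> ?w h" if "e \<in> A" for e
      using Max_ge[of "?w ` A" "?w e"] finite_items that h(2) by simp
    have big: "1/2 < ?w h"
    proof -
      from True obtain e where "e \<in> A" "1/2 < ?w e" by blast
      then show ?thesis using max[of e] by linarith
    qed
    have hE: "h \<in> ?E" "u \<in> ends I h" "h \<in> edges I" "h \<in> incident I u"
      using h(1) by (auto simp: A_def incident_def)
    have lower: "1 - g \<le> x h u"
      using remaining_lower_bound[OF valid x hE(1,2)] big g by (auto simp: f split: if_splits)
    have "L = {}"
    proof (rule ccontr)
      assume "L \<noteq> {}"
      then obtain e where e: "e \<in> L" by blast
      have "(\<Sum>e\<in>{e, h}. x e u) \<le> 1"
        by (rule starc) (use L(1,2)[OF e] hE(4) big in simp)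
      moreover have "e \<noteq> h" using L(4)[OF e] h(1) by blast
      ultimately show False using lower L(3)[OF e] by simp
    qed
    have star: "(\<Sum>e\<in>{e \<in> A. 1/2 < ?w e}. x e u) \<le> 1"
      by (rule starc) (auto simp: A_def)
    have "(\<Sum>e\<in>M. ?w e) \<le> (\<Sum>e\<in>A. x e u * ?w e) + ?w h * (1 - x h u) + x h u * (1/2)"
      using matched_size_le_star[OF M star _ h(1) big max] by simp
    also have "\<dots> \<le> 1 + ?w h * (1 - x h u) + x h u * (1/2)"
      using rem \<open>L = {}\<close> by simp
    also have "\<dots> \<le> 3/2 + g / 2"
    proof -
      \<comment> \<open>The bound \<open>1 + ?w h - x h u * (?w h - 1/2)\<close> decreases in
        \<open>x h u\<close>, so it is largest at \<open>x h u = 1 - g\<close>. There it equals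
        \<open>1 + g * ?w h + (1 - g) / 2\<close>, and \<open>?w h <= 1\<close> finishes.\<close>
      have "(1 - g) * (?w h - 1/2) \<le> x h u * (?w h - 1/2)"
        using lower big by (intro mult_right_mono) auto
      moreover have "g * ?w h \<le> g * 1" using w1[OF hE(3)] g by (intro mult_left_mono) auto
      ultimately show ?thesis by (simp add: algebra_simps diff_divide_distrib)
    qed
    finally show ?thesis using load \<open>L = {}\<close> by simp
  next
    case False
    have "(\<Sum>e\<in>M. ?w e) \<le> 1/2 + (\<Sum>e\<in>A. x e u * ?w e)"
    proof (rule matched_size_le[OF M])
      fix e assume "e \<in> M"
      with M(1) have "e \<in> A" by blast
      with False show "?w e \<le> 1/2" using not_less by blast
    qed auto
    \<comment> \<open>A local edge loads \<open>u\<close> with its whole weight but takes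
      \<open>x e u\<close> times that weight from the load constraint; the excess is
      \<open>?w e * (1 - x e u)\<close>.\<close>
    then have le: "load I \<eta> u \<le> 3/2 + (\<Sum>e\<in>L. ?w e * (1 - x e u))"
      using rem load by (simp add: algebra_simps sum_subtractf)
    have "(\<Sum>e\<in>L. ?w e * (1 - x e u)) \<le> 1 - g"
    proof (cases "L = {}")
      case True
      then show ?thesis using g by simp
    next
      case False
      then obtain e where e: "e \<in> L" by blast
      \<comment> \<open>Two local edges at \<open>u\<close> would take more than
        \<open>2 * g >= 4/3\<close> from the star constraint.\<close>
      have "L = {e}"
      proof (rule ccontr)
        assume "L \<noteq> {e}"
        then obtain e' where e': "e' \<in> L" "e' \<noteq> e" using e by blast
        have "(\<Sum>e\<in>{e, e'}. x e u) \<le> 1"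
          by (rule starc) (use L(1,2)[OF e] L(1,2)[OF e'(1)] in simp)
        then show False using e' L(3)[OF e] L(3)[OF e'(1)] g by simp
      qed
      moreover have "e \<in> edges I" using e by (simp add: L_def)
      then have "x e u \<le> 1" "?w e \<le> 1"
        using LP_EKS_le_1[OF valid x] L(1)[OF e] w1 by (auto simp: incident_def)
      then have "?w e * (1 - x e u) \<le> 1 * (1 - x e u)" by (intro mult_right_mono) auto
      ultimately show ?thesis using L(3)[OF e] by simp
    qed
    \<comment> \<open>The load is at most \<open>5/2 - g\<close>, which is at most
      \<open>3/2 + g / 2\<close> precisely when \<open>g >= 2/3\<close>.\<close>
    with le g show ?thesis by linarith
  qed
qed

section \<open>Scaling to target 1, and orientations as solutions of the relaxation\<close>

lemma makespan_le_iff: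
  assumes "gb_valid I" "0 \<le> c"
  shows "makespan I \<eta> \<le> c \<longleftrightarrow> (\<forall>u\<in>verts I. load I \<eta> u \<le> c)"
  using assms by (auto simp: makespan_def gb_valid_def)

lemma gb_valid_scaled: "gb_valid I \<Longrightarrow> 0 < T \<Longrightarrow> gb_valid (scaled I T)"
  by (auto simp: gb_valid_def scaled_def)

lemma makespan_scaled_le_iff:
  assumes "gb_valid I" "0 < T" "0 \<le> c"
  shows "makespan (scaled I T) \<eta> \<le> c \<longleftrightarrow> makespan I \<eta> \<le> c * T"
proof -
  have "load (scaled I T) \<eta> u = load I \<eta> u / T" for u
    by (simp add: load_def scaled_def sum_divide_distrib)
  moreover have "verts (scaled I T) = verts I" by (simp add: scaled_def)
  ultimately show ?thesis
    using assms gb_valid_scaled[OF assms(1,2)] by (simp add: makespan_le_iff pos_divide_le_eq)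
qed

lemma orientations_scaled: "orientations (scaled I T) = orientations I"
  by (simp add: orientations_def scaled_def)

lemma orientation_cost_scaled: "orientation_cost (scaled I T) \<eta> = orientation_cost I \<eta>"
  by (simp add: orientation_cost_def scaled_def)

lemma edge_weight_le_makespan:
  assumes "gb_valid I" "\<eta> \<in> orientations I" "e \<in> edges I"
  shows "weight I e \<le> makespan I \<eta>"
proof -
  have "\<eta> e \<in> verts I" using assms by (auto simp: orientations_def gb_valid_def PiE_iff)
  have "weight I e \<le> load I \<eta> (\<eta> e)"
    unfolding load_def using assms by (intro member_le_sum) (auto simp: gb_valid_def less_imp_le)
  also have "\<dots> \<le> makespan I \<eta>"
    unfolding makespan_def using assms(1) \<open>\<eta> e \<in> verts I\<close>
    by (intro Max_ge) (auto simp: gb_valid_def)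
  finally show ?thesis .
qed

text \<open>This makes the linear program a relaxation, so infeasibility is a sound report and its
  optimum a lower bound on the cost. The star constraint holds because two edges heavier than
  \<open>1/2\<close> cannot share a vertex of load at most 1.\<close>

lemma orientation_in_LP_EKS:
  assumes valid: "gb_valid I" and \<eta>: "\<eta> \<in> orientations I" and "makespan I \<eta> \<le> 1"
  shows "(\<lambda>e u. of_bool (\<eta> e = u)) \<in> LP_EKS I"
proof -
  have fin: "finite (edges I)" using valid by (simp add: gb_valid_def)
  have \<eta>_ends: "\<eta> e \<in> ends I e" if "e \<in> edges I" for e
    using \<eta> that by (auto simp: orientations_def)
  \<comment> \<open>One identity for both vertex constraints: \<open>P\<close> trivially true gives
    the load, \<open>P\<close> as \<open>weight I e > 1/2\<close> with \<open>g\<close> constantly 1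
    the star sum.\<close>
  have inc: "(\<Sum>e\<in>{e \<in> incident I u. P e}. of_bool (\<eta> e = u) * g e)
      = (\<Sum>e\<in>{e \<in> edges I. \<eta> e = u \<and> P e}. g e)" for u P and g :: "'b \<Rightarrow> real"
  proof -
    have "(\<Sum>e\<in>{e \<in> incident I u. P e}. of_bool (\<eta> e = u) * g e)
      = (\<Sum>e\<in>{e \<in> edges I. \<eta> e = u \<and> P e}. of_bool (\<eta> e = u) * g e)"
      using fin \<eta>_ends by (intro sum.mono_neutral_right) (auto simp: incident_def)
    then show ?thesis by simp
  qed
  have load: "load I \<eta> u \<le> 1" if "u \<in> verts I" for u
    using assms(3) makespan_le_iff[OF valid, of 1] that by simp
  have "(\<Sum>u\<in>ends I e. of_bool (\<eta> e = u)) = (1 :: real)" if "e \<in> edges I" for e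
    using finite_ends[OF valid that] \<eta>_ends[OF that] by (simp add: of_bool_def)
  moreover have "(\<Sum>e\<in>incident I u. of_bool (\<eta> e = u) * weight I e) \<le> 1" if "u \<in> verts I" for u
    using inc[of u "weight I" "\<lambda>_. True"] load[OF that] by (simp add: load_def)
  moreover have "(\<Sum>e\<in>{e \<in> incident I u. weight I e > 1/2}. of_bool (\<eta> e = u)) \<le> (1 :: real)"
    if "u \<in> verts I" for u
  proof -
    let ?S = "{e \<in> edges I. \<eta> e = u \<and> weight I e > 1/2}"
    have card: "(\<Sum>e\<in>{e \<in> incident I u. weight I e > 1/2}. of_bool (\<eta> e = u)) = real (card ?S)"
      using inc[of u "\<lambda>_. 1" "\<lambda>e. weight I e > 1/2"] by simp
    show ?thesis
    proof (cases "?S = {}")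
      case True
      show ?thesis unfolding card True by simp
    next
      case False
      \<comment> \<open>Strictness matters: \<open>card ?S\<close> big edges weigh strictly more
        than half their number, so there are fewer than 2.\<close>
      have "real (card ?S) * (1/2) = (\<Sum>e\<in>?S. 1/2)" by simp
      also have "\<dots> < (\<Sum>e\<in>?S. weight I e)"
        using fin False by (intro sum_strict_mono) auto
      also have "\<dots> \<le> load I \<eta> u"
        unfolding load_def using fin valid by (intro sum_mono2) (auto simp: gb_valid_def less_imp_le)
      finally have "real (card ?S) < 2" using load[OF that] by simp
      then show ?thesis unfolding card by simp
    qed
  qed
  ultimately show ?thesis by (simp add: LP_EKS_def)
qed

lemma fractional_cost_orientation:
  assumes valid: "gb_valid I" and \<eta>: "\<eta> \<in> orientations I"
  shows "fractional_cost I (\<lambda>e u. of_bool (\<eta> e = u)) = orientation_cost I \<eta>"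
  unfolding fractional_cost_def orientation_cost_def
proof (rule sum.cong[OF refl])
  fix e assume e: "e \<in> edges I"
  then have "\<eta> e \<in> ends I e" using \<eta> by (auto simp: orientations_def)
  then show "(\<Sum>u\<in>ends I e. ocost I e u * of_bool (\<eta> e = u)) = ocost I e (\<eta> e)"
    using finite_ends[OF valid e] by (simp add: of_bool_def if_distrib[of "(*) _"] cong: if_cong)
qed

theorem theorem8:
  fixes \<gamma> :: real
  assumes "1/12 \<le> \<gamma>" and "\<gamma> \<le> 1/4"
  shows "\<exists>f \<in> {0..1} \<rightarrow> {1/2..1}.
           gb_approximation (7/4 + \<gamma>) (1 / (2 * \<gamma> + 1/2))
             (framework (LP_EKS :: ('v, 'e) relaxation) f)"
proof
  define g where "g = 2 * \<gamma> + 1/2"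
  define f where "f = (\<lambda>p::real. if p \<le> 1/2 then 1 else g)"
  \<comment> \<open>The two hypotheses on \<gamma> are exactly these bounds, and
    \<open>3/2 + g / 2\<close> is \<open>7/4 + \<gamma>\<close>.\<close>
  have g: "2/3 \<le> g" "g \<le> 1" using assms by (auto simp: g_def)
  show "f \<in> {0..1} \<rightarrow> {1/2..1}" using g by (auto simp: f_def)
  show "gb_approximation (7/4 + \<gamma>) (1 / (2 * \<gamma> + 1/2)) (framework (LP_EKS :: ('v, 'e) relaxation) f)"
    unfolding gb_approximation_def
  proof (intro allI impI conjI)
    fix I :: "('v, 'e) gb_instance" and T :: real
    assume "gb_valid I \<and> 0 < T"
    then have valid: "gb_valid I" and T: "0 < T" by auto
    note validT = gb_valid_scaled[OF valid T]
    \<comment> \<open>Used twice: an empty relaxation refutes every orientation of makespan at most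
      \<open>T\<close>, and the optimal fractional cost is at most the cost of each of them.\<close>
    have feasible: "(\<lambda>e u. of_bool (\<eta> e = u)) \<in> LP_EKS (scaled I T)"
      if "\<eta> \<in> orientations I" "makespan I \<eta> \<le> T" for \<eta>
      by (rule orientation_in_LP_EKS[OF validT])
        (use that makespan_scaled_le_iff[OF valid T, of 1 \<eta>] orientations_scaled[of I T] in simp_all)
    show "\<exists>r. framework LP_EKS f I T r"
    proof (cases "(\<exists>e\<in>edges I. weight I e > T) \<or> LP_EKS (scaled I T) = {}")
      case True
      then show ?thesis by (blast intro: framework.report)
    next
      case False
      then have "LP_EKS (scaled I T) \<noteq> {}" by simp
      then obtain x where x: "optimal_solution LP_EKS (scaled I T) x"
        using optimal_solution_LP_EKS_exists[OF validT] by blast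
      then have "x \<in> LP_EKS (scaled I T)" by (simp add: optimal_solution_def)
      from rounding_exists[OF validT this] obtain \<eta> where "rounding f (scaled I T) x \<eta>" ..
      from framework.orient[OF False x this] show ?thesis ..
    qed
    fix r :: "('v, 'e) outcome"
    assume "framework LP_EKS f I T r"
    then show "case r of No_Orientation \<Rightarrow> \<not> (\<exists>\<eta>\<in>orientations I. makespan I \<eta> \<le> T)
      | Oriented \<eta> \<Rightarrow> \<eta> \<in> orientations I \<and> makespan I \<eta> \<le> (7/4 + \<gamma>) * T \<and>
          ereal (orientation_cost I \<eta>) \<le> ereal (1 / (2 * \<gamma> + 1/2)) * opt_cost I T"
    proof cases
      case report
      have "\<not> makespan I \<eta> \<le> T" if \<eta>: "\<eta> \<in> orientations I" for \<eta>
        using report(2)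
      proof
        assume "\<exists>e\<in>edges I. weight I e > T"
        then show ?thesis using edge_weight_le_makespan[OF valid \<eta>] by fastforce
      next
        assume "LP_EKS (scaled I T) = {}"
        then show ?thesis using feasible[OF \<eta>] by blast
      qed
      then show ?thesis using report(1) by simp
    next
      case (orient x \<eta>)
      have x: "x \<in> LP_EKS (scaled I T)" using orient(3) by (simp add: optimal_solution_def)
      have \<eta>: "\<eta> \<in> orientations I"
        using rounding_orientation[OF orient(4)] by (simp add: orientations_scaled)
      have w1: "weight (scaled I T) e \<le> 1" if "e \<in> edges (scaled I T)" for e
        using orient(2) that T by (auto simp: scaled_def not_less)
      have "load (scaled I T) \<eta> u \<le> 7/4 + \<gamma>" if "u \<in> verts (scaled I T)" for u
        using rounding_load_le[OF validT x orient(4) g f_def w1 that] by (simp add: g_def field_simps)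
      then have makespan: "makespan I \<eta> \<le> (7/4 + \<gamma>) * T"
        using makespan_le_iff[OF validT, of "7/4 + \<gamma>"]
          makespan_scaled_le_iff[OF valid T, of "7/4 + \<gamma>"] assms(1) by simp
      have cost: "orientation_cost I \<eta> \<le> 1 / g * orientation_cost I \<eta>'"
        if \<eta>': "\<eta>' \<in> orientations I" "makespan I \<eta>' \<le> T" for \<eta>'
      proof -
        have "orientation_cost I \<eta> \<le> 1 / g * fractional_cost (scaled I T) x"
          using rounding_cost_le[OF validT x orient(4), of g] g
          by (simp add: orientation_cost_scaled f_def)
        also have "fractional_cost (scaled I T) x \<le> orientation_cost I \<eta>'"
          using orient(3) feasible[OF \<eta>'] fractional_cost_orientation[OF validT] \<eta>'(1)
          by (metis optimal_solution_def orientation_cost_scaled orientations_scaled)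
        finally show ?thesis using g by (simp add: divide_right_mono)
      qed
      \<comment> \<open>With the factor moved to the left, the bound is a lower bound for every
        competitor and passes to the infimum. If there is no competitor, \<open>opt_cost I T\<close>
        is infinite and the bound still holds.\<close>
      have "ereal (g * orientation_cost I \<eta>) \<le> opt_cost I T"
        unfolding opt_cost_def
      proof (rule INF_greatest)
        fix \<eta>' assume "\<eta>' \<in> {\<eta> \<in> orientations I. makespan I \<eta> \<le> T}"
        then have "orientation_cost I \<eta> \<le> 1 / g * orientation_cost I \<eta>'" using cost by blast
        then show "ereal (g * orientation_cost I \<eta>) \<le> ereal (orientation_cost I \<eta>')"
          using g by (simp add: field_simps)
      qed
      then have "ereal (1 / g) * ereal (g * orientation_cost I \<eta>) \<le> ereal (1 / g) * opt_cost I T"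
        using g by (intro ereal_mult_left_mono) auto
      moreover have "ereal (1 / g) * ereal (g * orientation_cost I \<eta>) = ereal (orientation_cost I \<eta>)"
        using g by simp
      ultimately have "ereal (orientation_cost I \<eta>) \<le> ereal (1 / g) * opt_cost I T" by (simp only:)
      then show ?thesis using orient(1) \<eta> makespan by (simp add: g_def)
    qed
  qed
qed

end
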